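(* Let $N>1$ be an integer, let $\mathcal{X}\subseteq\mathbb{R}^N$ be a connected set with nonempty interior, let $\sigma>0$, and let $f:\mathcal{X}\to\mathbb{R}$ be given by $f(x)=-\sum_{j\in\mathcal{C}}a_jx^j$ for all $x\in\mathcal{X}$, with $\{a_j\}_{j\in\mathcal{C}}\subset\mathbb{R}$. Assume $0\in\mathcal X$, $f(0)=0$, $f(x)<0$ for all $x\in\mathcal{X}\setminus\{0\}$, and $\int_{\mathcal{X}}\frac{1}{|f(x)+p|}\,\mathrm{d}x<+\infty$ for every $p<0$. Let $\{i_k\}_{k\in\{1,\dots,N\}}$ be a permutation of $\{1,\dots,N\}$. Suppose there exist two multi-indices $j_1,j_2\in\mathcal{C}$ with $a_{j_1},a_{j_2}>0$ such that $j_1$ (resp. $j_2$) is zero everywhere except in the $i_1$-th (resp. $i_2$-th) position, where it equals $1$. Let $Q=\operatorname{I}$ be the identity on $L^2(\mathcal{X})$, and for $p<0$ let $V_\infty$ be the time-asymptotic covariance operator of the solution of $\mathrm{d}u(x,t)=(f(x)+p)\,u(x,t)\,\mathrm{d}t+\sigma\,\mathrm{d}W(t)$. Then $$\lim_{p\to0^-}\langle V_\infty g,g\rangle<\infty$$ for every $\varepsilon>0$ with $[0,\varepsilon]^N\subseteq\mathcal{X}$ and $g=\mathbbm{1}_{[0,\varepsilon]^N}$.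
   Context: $\mathcal{C}=(\mathbb{N}\cup\{0\})^N$ is the set of multi-indices with $\mathbb N=\{1,2,\dots\}$; for $j=(k_1,\dots,k_N)\in\mathcal C$ and $x=(x_1,\dots,x_N)$, $x^j=\prod_{n=1}^Nx_n^{k_n}$. $L^2(\mathcal{X})$ is the real Hilbert space of square-integrable functions with usual scalar product $\langle\cdot,\cdot\rangle$, and $\mathbbm{1}_S$ is the indicator function of $S$. $\operatorname{T}_{h}$ denotes the multiplication operator $u\mapsto hu$ in $L^2(\mathcal{X})$. $W$ is a (generalized) $Q$-Wiener process with covariance operator $Q$. The covariance operator at time $t>0$ of the mild solution of the stochastic equation is $$V(t):=\sigma^2\int_0^t e^{\operatorname{T}_{f+p}s}\,Q\,e^{\operatorname{T}_{f+p}s}\,\mathrm{d}s,$$ and the time-asymptotic covariance operator is $V_\infty:=\lim_{t\to\infty}V(t)$ (it depends on $p<0$). *)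

theory Defs
  imports "HOL-Analysis.Analysis"
begin

section \<open>The real Hilbert space of square-integrable functions\<close>

definition square_integrable :: "('a::euclidean_space \<Rightarrow> real) \<Rightarrow> bool" where
  "square_integrable u \<longleftrightarrow>
     u \<in> borel_measurable lebesgue \<and> integrable lebesgue (\<lambda>x. (u x)\<^sup>2)"

lemma square_integrable_mult:
  assumes "square_integrable u" "square_integrable v"
  shows "integrable lebesgue (\<lambda>x. u x * v x)"
proof (rule Bochner_Integration.integrable_bound)
  show "integrable lebesgue (\<lambda>x. (u x)\<^sup>2 + (v x)\<^sup>2)"
    using assms by (auto simp: square_integrable_def)
  show "(\<lambda>x. u x * v x) \<in> borel_measurable lebesgue"
    using assms by (auto simp: square_integrable_def)
  have "\<bar>a * b\<bar> \<le> a\<^sup>2 + b\<^sup>2" for a b :: real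
  proof -
    have "0 \<le> (\<bar>a\<bar> - \<bar>b\<bar>)\<^sup>2" by simp
    then have "2 * \<bar>a * b\<bar> \<le> a\<^sup>2 + b\<^sup>2" by (simp add: power2_diff abs_mult)
    then show ?thesis by linarith
  qed
  then show "AE x in lebesgue. norm (u x * v x) \<le> norm ((u x)\<^sup>2 + (v x)\<^sup>2)"
    by simp
qed

lemma square_integrable_add:
  assumes "square_integrable u" "square_integrable v"
  shows "square_integrable (\<lambda>x. u x + v x)"
proof -
  have "integrable lebesgue (\<lambda>x. (u x)\<^sup>2 + (v x)\<^sup>2 + 2 * (u x * v x))"
    using assms square_integrable_mult[OF assms] by (auto simp: square_integrable_def)
  then show ?thesis
    using assms by (auto simp: square_integrable_def power2_sum mult.assoc)
qed

lemma square_integrable_scale: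
  "square_integrable u \<Longrightarrow> square_integrable (\<lambda>x. c * u x)"
  by (auto simp: square_integrable_def power_mult_distrib)

lemma square_integrable_zero: "square_integrable (\<lambda>x. 0)"
  by (auto simp: square_integrable_def)

definition L2_rel :: "('a::euclidean_space \<Rightarrow> real) \<Rightarrow> ('a \<Rightarrow> real) \<Rightarrow> bool" where
  "L2_rel u v \<longleftrightarrow>
     square_integrable u \<and> square_integrable v \<and> (AE x in lebesgue. u x = v x)"

lemma L2_rel_part_equivp: "part_equivp (L2_rel :: ('a::euclidean_space \<Rightarrow> real) \<Rightarrow> _)"
proof (rule part_equivpI)
  show "\<exists>u::'a \<Rightarrow> real. L2_rel u u"
    by (rule exI[of _ "\<lambda>x. 0"]) (simp add: L2_rel_def square_integrable_zero)
  show "symp (L2_rel :: ('a \<Rightarrow> real) \<Rightarrow> _)"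
    by (auto simp: symp_def L2_rel_def elim: AE_mp)
  show "transp (L2_rel :: ('a \<Rightarrow> real) \<Rightarrow> _)"
  proof (rule transpI)
    fix u v w :: "'a \<Rightarrow> real"
    assume a: "L2_rel u v" "L2_rel v w"
    then have "AE x in lebesgue. u x = v x" "AE x in lebesgue. v x = w x"
      by (auto simp: L2_rel_def)
    then have "AE x in lebesgue. u x = w x"
      by eventually_elim simp
    with a show "L2_rel u w"
      by (auto simp: L2_rel_def)
  qed
qed

quotient_type (overloaded) 'a L2 = "'a::euclidean_space \<Rightarrow> real" / partial: L2_rel
  morphisms L2_fun L2_class
  by (rule L2_rel_part_equivp)

text \<open>
  \<^term>\<open>L2_fun u\<close> is some representative of the class \<^term>\<open>u\<close>; only almost-everywhere
  statements about it are meaningful.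
\<close>

lemma L2_fun_square_integrable: "square_integrable (L2_fun u)"
  using Quotient3_rep_reflp[OF Quotient3_L2, of u] by (simp add: L2_rel_def)

lemma L2_class_fun: "L2_class (L2_fun u) = u"
  using Quotient3_L2 by (rule Quotient3_abs_rep)

lemma L2_eq_iff: "u = v \<longleftrightarrow> (AE x in lebesgue. L2_fun u x = L2_fun v x)"
  using Quotient3_rel_rep[OF Quotient3_L2, of u v]
  by (auto simp: L2_rel_def L2_fun_square_integrable)

lemma L2_fun_class:
  assumes "square_integrable u"
  shows "AE x in lebesgue. L2_fun (L2_class u) x = u x"
proof -
  have "L2_rel u u" using assms by (simp add: L2_rel_def)
  then have "L2_rel (L2_fun (L2_class u)) u"
    by (rule rep_abs_rsp_left[OF Quotient3_L2])
  then show ?thesis by (simp add: L2_rel_def)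
qed

instantiation L2 :: (euclidean_space) real_vector
begin

lift_definition zero_L2 :: "'a L2" is "\<lambda>x. 0"
  by (simp add: L2_rel_def square_integrable_zero)

lift_definition plus_L2 :: "'a L2 \<Rightarrow> 'a L2 \<Rightarrow> 'a L2" is "\<lambda>u v x. u x + v x"
  by (auto simp: L2_rel_def square_integrable_add elim: AE_mp)

lift_definition scaleR_L2 :: "real \<Rightarrow> 'a L2 \<Rightarrow> 'a L2" is "\<lambda>c u x. c * u x"
  by (auto simp: L2_rel_def square_integrable_scale elim: AE_mp)

definition uminus_L2 :: "'a L2 \<Rightarrow> 'a L2" where "uminus_L2 u = (-1) *\<^sub>R u"
definition minus_L2 :: "'a L2 \<Rightarrow> 'a L2 \<Rightarrow> 'a L2" where "minus_L2 u v = u + (- v)"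

instance
proof
  fix u v w :: "'a L2" and c d :: real
  show "u + v + w = u + (v + w)"
    by transfer (simp add: L2_rel_def square_integrable_add add.assoc)
  show "u + v = v + u"
    by transfer (simp add: L2_rel_def square_integrable_add add.commute)
  show "0 + u = u"
    by transfer (simp add: L2_rel_def)
  show "- u + u = 0"
    unfolding uminus_L2_def
    by transfer (simp add: L2_rel_def square_integrable_zero)
  show "u - v = u + - v"
    by (rule minus_L2_def)
  show "c *\<^sub>R (u + v) = c *\<^sub>R u + c *\<^sub>R v"
    by transfer (simp add: L2_rel_def square_integrable_add square_integrable_scale distrib_left)
  show "(c + d) *\<^sub>R u = c *\<^sub>R u + d *\<^sub>R u"
    by transfer (simp add: L2_rel_def square_integrable_add square_integrable_scale distrib_right)
  show "c *\<^sub>R d *\<^sub>R u = (c * d) *\<^sub>R u"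
    by transfer (simp add: L2_rel_def square_integrable_scale mult.assoc)
  show "1 *\<^sub>R u = u"
    by transfer (simp add: L2_rel_def)
qed

end

instantiation L2 :: (euclidean_space) real_inner
begin

lift_definition inner_L2 :: "'a L2 \<Rightarrow> 'a L2 \<Rightarrow> real" is "\<lambda>u v. \<integral>x. u x * v x \<partial>lebesgue"
  by (rule integral_cong_AE) (auto simp: L2_rel_def square_integrable_def elim: AE_mp)

definition norm_L2 :: "'a L2 \<Rightarrow> real" where "norm_L2 u = sqrt (inner u u)"
definition sgn_L2 :: "'a L2 \<Rightarrow> 'a L2" where "sgn_L2 u = u /\<^sub>R norm u"
definition dist_L2 :: "'a L2 \<Rightarrow> 'a L2 \<Rightarrow> real" where "dist_L2 u v = norm (u - v)"
definition uniformity_L2 :: "('a L2 \<times> 'a L2) filter" where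
  "uniformity_L2 = (INF e\<in>{0 <..}. principal {(x, y). dist x y < e})"
definition open_L2 :: "'a L2 set \<Rightarrow> bool" where
  "open_L2 U \<longleftrightarrow> (\<forall>x\<in>U. eventually (\<lambda>(x', y). x' = x \<longrightarrow> y \<in> U) uniformity)"

instance
proof
  fix u v w :: "'a L2" and c :: real
  show "sgn u = u /\<^sub>R norm u"
    by (rule sgn_L2_def)
  show "dist u v = norm (u - v)"
    by (rule dist_L2_def)
  show "(uniformity :: ('a L2 \<times> 'a L2) filter) = (INF e\<in>{0 <..}. principal {(x, y). dist x y < e})"
    by (rule uniformity_L2_def)
  show "open U = (\<forall>x\<in>U. \<forall>\<^sub>F (x', y) in uniformity. x' = x \<longrightarrow> y \<in> U)" for U :: "'a L2 set"
    by (rule open_L2_def)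
  show "inner u v = inner v u"
    by transfer (simp add: mult.commute)
  show "inner (u + v) w = inner u w + inner v w"
    by transfer (simp add: L2_rel_def distrib_right square_integrable_mult)
  show "inner (c *\<^sub>R u) v = c * inner u v"
    by transfer (simp add: mult.assoc)
  show "0 \<le> inner u u"
    by transfer simp
  show "inner u u = 0 \<longleftrightarrow> u = 0"
  proof transfer
    fix u :: "'a \<Rightarrow> real"
    assume u: "L2_rel u u"
    then have "integrable lebesgue (\<lambda>x. u x * u x)"
      by (simp add: L2_rel_def square_integrable_mult)
    then have "(\<integral>x. u x * u x \<partial>lebesgue) = 0 \<longleftrightarrow> (AE x in lebesgue. u x * u x = 0)"
      by (subst integral_nonneg_eq_0_iff_AE) auto
    with u show "(\<integral>x. u x * u x \<partial>lebesgue) = 0 \<longleftrightarrow> L2_rel u (\<lambda>x. 0)"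
      by (simp add: L2_rel_def square_integrable_zero)
  qed
  show "norm u = sqrt (inner u u)"
    by (rule norm_L2_def)
qed

end

lemma L2_fun_zero: "AE x in lebesgue. L2_fun 0 x = 0"
  unfolding zero_L2_def by (intro L2_fun_class square_integrable_zero)

lemma L2_fun_add: "AE x in lebesgue. L2_fun (u + v) x = L2_fun u x + L2_fun v x"
proof -
  have "u + v = L2_class (\<lambda>x. L2_fun u x + L2_fun v x)"
    by (simp add: plus_L2_def map_fun_def)
  then show ?thesis
    by (simp add: L2_fun_class square_integrable_add L2_fun_square_integrable)
qed

lemma L2_fun_scaleR: "AE x in lebesgue. L2_fun (c *\<^sub>R u) x = c * L2_fun u x"
proof -
  have "c *\<^sub>R u = L2_class (\<lambda>x. c * L2_fun u x)"
    by (simp add: scaleR_L2_def map_fun_def)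
  then show ?thesis
    by (simp add: L2_fun_class square_integrable_scale L2_fun_square_integrable)
qed

lemma L2_fun_diff: "AE x in lebesgue. L2_fun (u - v) x = L2_fun u x - L2_fun v x"
proof -
  have "AE x in lebesgue. L2_fun (u + (-1) *\<^sub>R v) x = L2_fun u x + L2_fun ((-1) *\<^sub>R v) x"
    "AE x in lebesgue. L2_fun ((-1) *\<^sub>R v) x = (-1) * L2_fun v x"
    by (rule L2_fun_add, rule L2_fun_scaleR)
  then have "AE x in lebesgue. L2_fun (u + (-1) *\<^sub>R v) x = L2_fun u x - L2_fun v x"
    by eventually_elim simp
  then show ?thesis by simp
qed

lemma inner_L2_fun: "inner u v = (\<integral>x. L2_fun u x * L2_fun v x \<partial>lebesgue)"
  by (simp add: inner_L2_def map_fun_def)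

lemma nn_integral_L2_fun:
  "(\<integral>\<^sup>+x. ennreal ((L2_fun u x)\<^sup>2) \<partial>lebesgue) = ennreal ((norm u)\<^sup>2)"
proof -
  have "integrable lebesgue (\<lambda>x. (L2_fun u x)\<^sup>2)"
    using L2_fun_square_integrable[of u] by (simp add: square_integrable_def)
  then show ?thesis
    by (subst nn_integral_eq_integral) (auto simp: power2_norm_eq_inner inner_L2_fun power2_eq_square[of "L2_fun u _"])
qed

instance L2 :: (euclidean_space) complete_space
proof
  fix X :: "nat \<Rightarrow> 'a L2"
  assume cau: "Cauchy X"
  have ex: "\<exists>N. \<forall>m\<ge>N. \<forall>n\<ge>N. norm (X m - X n) < (1/4)^k" for k :: nat
    using CauchyD[OF cau, of "(1/4)^k"] by simp
  then obtain N where N: "\<And>k m n. m \<ge> N k \<Longrightarrow> n \<ge> N k \<Longrightarrow> norm (X m - X n) < (1/4)^k"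
    by metis
  define r where "r = rec_nat (N 0) (\<lambda>k s. max (Suc s) (N (Suc k)))"
  have r_Suc: "r (Suc k) = max (Suc (r k)) (N (Suc k))" for k
    by (simp add: r_def)
  have rN: "r k \<ge> N k" for k
    by (cases k) (simp_all add: r_def)
  have mono: "strict_mono r"
    by (rule strict_monoI_Suc) (simp add: r_Suc less_max_iff_disj)
  define d where "d k x = L2_fun (X (r (Suc k)) - X (r k)) x" for k x
  have dm [measurable]: "d k \<in> borel_measurable lebesgue" for k
    using L2_fun_square_integrable[of "X (r (Suc k)) - X (r k)"]
    by (simp add: d_def[abs_def] square_integrable_def)
  have um [measurable]: "L2_fun u \<in> borel_measurable lebesgue" for u :: "'a L2"
    using L2_fun_square_integrable[of u] by (simp add: square_integrable_def)
  have dint: "(\<integral>\<^sup>+x. ennreal ((d k x)\<^sup>2) \<partial>lebesgue) \<le> ennreal ((1/16)^k)" for k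
  proof -
    have "r k \<le> r (Suc k)" by (simp add: r_Suc)
    then have "norm (X (r (Suc k)) - X (r k)) < (1/4)^k"
      using rN[of k] by (intro N) auto
    then have "(norm (X (r (Suc k)) - X (r k)))\<^sup>2 \<le> ((1/4)^k)\<^sup>2"
      by (intro power_mono) auto
    also have "((1/4)^k)\<^sup>2 = ((1/16)^k :: real)"
      by (simp add: power2_eq_square flip: power_mult_distrib)
    finally show ?thesis
      unfolding d_def nn_integral_L2_fun by (rule ennreal_leI)
  qed
  have "(\<integral>\<^sup>+x. (\<Sum>k. ennreal (4^k * (d k x)\<^sup>2)) \<partial>lebesgue)
      = (\<Sum>k. \<integral>\<^sup>+x. ennreal (4^k * (d k x)\<^sup>2) \<partial>lebesgue)"
    by (rule nn_integral_suminf) measurable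
  also have "\<dots> \<le> (\<Sum>k. ennreal ((1/4)^k))"
  proof (rule suminf_le)
    fix k
    have "(\<integral>\<^sup>+x. ennreal (4^k * (d k x)\<^sup>2) \<partial>lebesgue)
        = ennreal (4^k) * (\<integral>\<^sup>+x. ennreal ((d k x)\<^sup>2) \<partial>lebesgue)"
      by (subst nn_integral_cmult[symmetric]) (auto simp: ennreal_mult)
    also have "\<dots> \<le> ennreal (4^k) * ennreal ((1/16)^k)"
      by (intro mult_left_mono dint) auto
    also have "\<dots> = ennreal (4^k * (1/16)^k)"
      by (simp add: ennreal_mult)
    also have "4^k * (1/16)^k = ((1/4)^k :: real)"
      by (simp flip: power_mult_distrib)
    finally show "(\<integral>\<^sup>+x. ennreal (4^k * (d k x)\<^sup>2) \<partial>lebesgue) \<le> ennreal ((1/4)^k)" .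
  qed auto
  also have "\<dots> < \<infinity>"
    by (subst suminf_ennreal2) (auto simp: summable_geometric)
  finally have fin: "(\<integral>\<^sup>+x. (\<Sum>k. ennreal (4^k * (d k x)\<^sup>2)) \<partial>lebesgue) \<noteq> \<infinity>"
    by simp
  have "AE x in lebesgue. (\<Sum>k. ennreal (4^k * (d k x)\<^sup>2)) \<noteq> \<infinity>"
    by (rule nn_integral_PInf_AE[OF _ fin]) measurable
  moreover have "AE x in lebesgue. \<forall>k. d k x = L2_fun (X (r (Suc k))) x - L2_fun (X (r k)) x"
    unfolding AE_all_countable d_def by (intro allI L2_fun_diff)
  ultimately have conv: "AE x in lebesgue. convergent (\<lambda>k. L2_fun (X (r k)) x)"
  proof eventually_elim
    fix x
    assume fs: "(\<Sum>k. ennreal (4^k * (d k x)\<^sup>2)) \<noteq> \<infinity>"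
      and dx: "\<forall>k. d k x = L2_fun (X (r (Suc k))) x - L2_fun (X (r k)) x"
    have "summable (\<lambda>k. 4^k * (d k x)\<^sup>2)"
      by (rule summable_suminf_not_top) (use fs in auto)
    then have "Bseq (\<lambda>k. 4^k * (d k x)\<^sup>2)"
      by (intro convergent_imp_Bseq) (auto dest: summable_LIMSEQ_zero simp: convergent_def)
    then obtain K where K: "K > 0" "\<And>k. \<bar>4^k * (d k x)\<^sup>2\<bar> \<le> K"
      by (auto simp: Bseq_def)
    have "summable (\<lambda>k. d k x)"
    proof (rule summable_comparison_test'[where N=0])
      show "summable (\<lambda>k. sqrt K * (1/2)^k)"
        by (intro summable_mult summable_geometric) auto
      fix k :: nat
      have "(2^k * \<bar>d k x\<bar>)\<^sup>2 = 4^k * (d k x)\<^sup>2"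
        by (simp add: power_mult_distrib power_mult[symmetric] mult.commute[of k] power_mult)
      also have "\<dots> \<le> K" using K(2)[of k] by simp
      finally have "2^k * \<bar>d k x\<bar> \<le> sqrt K" by (rule real_le_rsqrt)
      then show "norm (d k x) \<le> sqrt K * (1/2)^k"
        by (simp add: field_simps)
    qed
    then have "convergent (\<lambda>n. (\<Sum>k<n. d k x) + L2_fun (X (r 0)) x)"
      by (intro convergent_add) (auto simp: summable_iff_convergent convergent_const)
    moreover have "(\<Sum>k<n. d k x) + L2_fun (X (r 0)) x = L2_fun (X (r n)) x" for n
      using dx by (induction n) auto
    ultimately show "convergent (\<lambda>k. L2_fun (X (r k)) x)" by simp
  qed
  define U where "U x = lim (\<lambda>k. L2_fun (X (r k)) x)" for x
  have Um [measurable]: "U \<in> borel_measurable lebesgue"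
    unfolding U_def[abs_def] by measurable
  have dist_le: "(\<integral>\<^sup>+x. ennreal ((U x - L2_fun (X n) x)\<^sup>2) \<partial>lebesgue) \<le> ennreal (e\<^sup>2)"
    if "\<And>m. m \<ge> M \<Longrightarrow> norm (X m - X n) \<le> e" for n M e
  proof -
    have "(\<integral>\<^sup>+x. ennreal ((U x - L2_fun (X n) x)\<^sup>2) \<partial>lebesgue)
        = (\<integral>\<^sup>+x. liminf (\<lambda>k. ennreal ((L2_fun (X (r k)) x - L2_fun (X n) x)\<^sup>2)) \<partial>lebesgue)"
    proof (rule nn_integral_cong_AE, use conv in eventually_elim)
      fix x assume "convergent (\<lambda>k. L2_fun (X (r k)) x)"
      then have "(\<lambda>k. L2_fun (X (r k)) x) \<longlonglongrightarrow> U x"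
        unfolding U_def by (simp add: convergent_LIMSEQ_iff)
      then have "(\<lambda>k. ennreal ((L2_fun (X (r k)) x - L2_fun (X n) x)\<^sup>2))
          \<longlonglongrightarrow> ennreal ((U x - L2_fun (X n) x)\<^sup>2)"
        by (intro tendsto_intros tendsto_ennrealI)
      then show "ennreal ((U x - L2_fun (X n) x)\<^sup>2)
          = liminf (\<lambda>k. ennreal ((L2_fun (X (r k)) x - L2_fun (X n) x)\<^sup>2))"
        by (intro lim_imp_Liminf[symmetric]) auto
    qed
    also have "\<dots> \<le> liminf (\<lambda>k. \<integral>\<^sup>+x. ennreal ((L2_fun (X (r k)) x - L2_fun (X n) x)\<^sup>2) \<partial>lebesgue)"
      by (rule nn_integral_liminf) measurable
    also have "\<dots> \<le> ennreal (e\<^sup>2)"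
    proof (rule order_trans[OF Liminf_le_Limsup Limsup_bounded])
      show "\<forall>\<^sub>F k in sequentially.
          (\<integral>\<^sup>+x. ennreal ((L2_fun (X (r k)) x - L2_fun (X n) x)\<^sup>2) \<partial>lebesgue) \<le> ennreal (e\<^sup>2)"
      proof (rule eventually_sequentiallyI)
        fix k assume "M \<le> k"
        then have "M \<le> r k" using seq_suble[OF mono, of k] by linarith
        have "(\<integral>\<^sup>+x. ennreal ((L2_fun (X (r k)) x - L2_fun (X n) x)\<^sup>2) \<partial>lebesgue)
            = (\<integral>\<^sup>+x. ennreal ((L2_fun (X (r k) - X n) x)\<^sup>2) \<partial>lebesgue)"
          by (rule nn_integral_cong_AE, use L2_fun_diff[of "X (r k)" "X n"] in eventually_elim) simp
        also have "\<dots> \<le> ennreal (e\<^sup>2)"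
          unfolding nn_integral_L2_fun
          by (intro ennreal_leI power_mono that \<open>M \<le> r k\<close>) auto
        finally show "(\<integral>\<^sup>+x. ennreal ((L2_fun (X (r k)) x - L2_fun (X n) x)\<^sup>2) \<partial>lebesgue)
            \<le> ennreal (e\<^sup>2)" .
      qed
    qed simp
    finally show ?thesis .
  qed
  have "(\<integral>\<^sup>+x. ennreal ((U x - L2_fun (X (N 0)) x)\<^sup>2) \<partial>lebesgue) \<le> ennreal (1\<^sup>2)"
    by (rule dist_le[of "N 0"]) (use N[of 0 _ "N 0"] in \<open>auto intro: less_imp_le\<close>)
  also have "\<dots> < \<infinity>" by simp
  finally have "square_integrable (\<lambda>x. U x - L2_fun (X (N 0)) x)"
    by (auto simp: square_integrable_def integrable_iff_bounded)
  from square_integrable_add[OF this L2_fun_square_integrable[of "X (N 0)"]]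
  have U: "square_integrable U" by simp
  have "X \<longlonglongrightarrow> L2_class U"
  proof (rule LIMSEQ_I)
    fix e :: real assume "e > 0"
    then obtain M where M: "\<And>m n. m \<ge> M \<Longrightarrow> n \<ge> M \<Longrightarrow> norm (X m - X n) < e / 2"
      using CauchyD[OF cau, of "e / 2"] by auto
    have "norm (X n - L2_class U) < e" if "n \<ge> M" for n
    proof -
      have "ennreal ((norm (L2_class U - X n))\<^sup>2)
          = (\<integral>\<^sup>+x. ennreal ((U x - L2_fun (X n) x)\<^sup>2) \<partial>lebesgue)"
        unfolding nn_integral_L2_fun[symmetric]
        by (rule nn_integral_cong_AE,
            use L2_fun_diff[of "L2_class U" "X n"] L2_fun_class[OF U] in eventually_elim) simp
      also have "\<dots> \<le> ennreal ((e/2)\<^sup>2)"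
        by (rule dist_le[of M]) (use M that in \<open>auto intro: less_imp_le\<close>)
      finally have "(norm (L2_class U - X n))\<^sup>2 \<le> (e/2)\<^sup>2"
        by (subst (asm) ennreal_le_iff) auto
      then have "norm (L2_class U - X n) \<le> e/2"
        by (rule power2_le_imp_le) (use \<open>e > 0\<close> in auto)
      then show ?thesis using \<open>e > 0\<close> by (simp add: norm_minus_commute)
    qed
    then show "\<exists>M. \<forall>n\<ge>M. norm (X n - L2_class U) < e" by blast
  qed
  then show "convergent X" by (auto simp: convergent_def)
qed

instance L2 :: (euclidean_space) banach ..

text \<open>
  \<open>L\<^sup>2(X)\<close> is the closed subspace of classes vanishing almost everywhere outside \<open>X\<close>, that is,
  functions on \<open>X\<close> are extended by zero.
\<close>

definition L2_on :: "'a::euclidean_space set \<Rightarrow> 'a L2 set" where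
  "L2_on X = {u. AE x in lebesgue. x \<notin> X \<longrightarrow> L2_fun u x = 0}"


section \<open>Multiplication operators and the semigroups they generate\<close>

text \<open>
  Multiplication by an unbounded function is only partially defined, hence the operator is given
  by its graph, on its maximal domain \<open>{u \<in> L\<^sup>2(X). h u \<in> L\<^sup>2(X)}\<close>.
\<close>

definition mult_op :: "'a::euclidean_space set \<Rightarrow> ('a \<Rightarrow> real) \<Rightarrow> ('a L2 \<times> 'a L2) set" where
  "mult_op X h = {(u, v). u \<in> L2_on X \<and> v \<in> L2_on X \<and>
     (AE x in lebesgue. x \<in> X \<longrightarrow> L2_fun v x = h x * L2_fun u x)}"

text \<open>The semigroups live on a subspace \<open>H\<close>; what they do outside \<open>H\<close> is irrelevant.\<close>

definition C0_semigroup :: "'h::real_normed_vector set \<Rightarrow> (real \<Rightarrow> 'h \<Rightarrow> 'h) \<Rightarrow> bool" where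
  "C0_semigroup H S \<longleftrightarrow>
     (\<forall>t\<ge>0. (\<forall>u\<in>H. S t u \<in> H) \<and>
        (\<forall>u\<in>H. \<forall>v\<in>H. S t (u + v) = S t u + S t v) \<and>
        (\<forall>c. \<forall>u\<in>H. S t (c *\<^sub>R u) = c *\<^sub>R S t u) \<and>
        (\<exists>B. \<forall>u\<in>H. norm (S t u) \<le> B * norm u)) \<and>
     (\<forall>u\<in>H. S 0 u = u) \<and>
     (\<forall>s\<ge>0. \<forall>t\<ge>0. \<forall>u\<in>H. S (s + t) u = S s (S t u)) \<and>
     (\<forall>u\<in>H. continuous_on {0..} (\<lambda>t. S t u))"

definition generator :: "'h::real_normed_vector set \<Rightarrow> (real \<Rightarrow> 'h \<Rightarrow> 'h) \<Rightarrow> ('h \<times> 'h) set" where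
  "generator H S = {(u, v). u \<in> H \<and> v \<in> H \<and>
     ((\<lambda>t. (S t u - u) /\<^sub>R t) \<longlongrightarrow> v) (at_right 0)}"

text \<open>\<open>e\<^bsup>As\<^esup>u\<close>: a strongly continuous semigroup is determined by its generator \<open>A\<close>.\<close>

definition semigroup_exp ::
    "'h::real_normed_vector set \<Rightarrow> ('h \<times> 'h) set \<Rightarrow> real \<Rightarrow> 'h \<Rightarrow> 'h" where
  "semigroup_exp H A s u = (THE w. \<exists>S. C0_semigroup H S \<and> generator H S = A \<and> w = S s u)"


section \<open>Covariance operators\<close>

text \<open>
  For \<open>du = h u dt + \<sigma> dW\<close> with a \<open>Q\<close>-Wiener process \<open>W\<close>. The operator-valued integral and the
  limit for \<open>t \<rightarrow> \<infinity>\<close> are taken in the strong sense. The second factor \<open>e\<^bsup>T s\<^esup>\<close> is not adjoined,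
  since multiplication operators by real functions are self-adjoint.
\<close>

definition covariance_op ::
    "'a::euclidean_space set \<Rightarrow> ('a \<Rightarrow> real) \<Rightarrow> real \<Rightarrow> ('a L2 \<Rightarrow> 'a L2) \<Rightarrow> real \<Rightarrow> 'a L2 \<Rightarrow> 'a L2" where
  "covariance_op X h \<sigma> Q t u =
     \<sigma>\<^sup>2 *\<^sub>R integral {0..t} (\<lambda>s. semigroup_exp (L2_on X) (mult_op X h) s
                             (Q (semigroup_exp (L2_on X) (mult_op X h) s u)))"

definition asymptotic_covariance_op ::
    "'a::euclidean_space set \<Rightarrow> ('a \<Rightarrow> real) \<Rightarrow> real \<Rightarrow> ('a L2 \<Rightarrow> 'a L2) \<Rightarrow> 'a L2 \<Rightarrow> 'a L2" where
  "asymptotic_covariance_op X h \<sigma> Q u = Lim at_top (\<lambda>t. covariance_op X h \<sigma> Q t u)"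


section \<open>Multi-indices\<close>

definition monomial :: "real ^ 'n \<Rightarrow> ('n::finite \<Rightarrow> nat) \<Rightarrow> real" where
  "monomial x j = (\<Prod>n\<in>UNIV. (x $ n) ^ j n)"

definition unit_index :: "'n \<Rightarrow> 'n \<Rightarrow> nat" where
  "unit_index m = (\<lambda>n. if n = m then 1 else 0)"

end

theory Submission
  imports Defs
begin

text \<open>
  The proof has an operator-theoretic and an analytic half, which meet in the formula
  \<open>\<langle>V\<^sub>\<infinity> g, g\<rangle> = \<sigma>\<^sup>2 / 2 * \<integral>\<^sub>B 1 / \<bar>f + p\<bar>\<close> for the indicator function \<open>g\<close> of the box \<open>B\<close>
  (\<open>inner_asymptotic_covariance_indicator\<close>).

  The operator half identifies the semigroup: multiplication by \<open>exp (t h)\<close>, where \<open>h = f + p\<close>, is a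
  strongly continuous semigroup whose generator is multiplication by \<open>h\<close> on its maximal domain
  (\<open>flow_C0_semigroup\<close>, \<open>generator_flow\<close>). Since \<open>h \<le> 0\<close>, the generator is dissipative, so two
  semigroups that share it cannot separate on its domain: the squared distance of two orbits has a
  nonpositive right derivative (\<open>generator_determines_orbit\<close>). The series defining \<open>f\<close> converges
  absolutely at the corner of \<open>B\<close>, hence \<open>h\<close> is bounded on \<open>B\<close> and \<open>g\<close> lies in the domain. With
  \<open>Q = I\<close> the covariance integrand is multiplication by \<open>exp (2 s h)\<close>, with antiderivative
  \<open>exp (2 s h) / (2 h)\<close>, which vanishes as \<open>s\<close> tends to infinity because \<open>h \<le> p < 0\<close>.

  As \<open>p\<close> increases to \<open>0\<close> the integrals converge, by dominated convergence, once \<open>1 / \<bar>f\<bar>\<close> is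
  integrable over \<open>B\<close>. This is the analytic half. Let \<open>F = - f\<close>, let \<open>k\<close> and \<open>l\<close> be the two directions
  with positive linear coefficient, and let \<open>y\<close> be \<open>x\<close> with the coordinates \<open>k\<close> and \<open>l\<close> set to \<open>0\<close>.
  Then \<open>F y \<ge> 0\<close> by assumption, and \<open>F x - F y\<close> collects the monomials that contain \<open>x\<^sub>k\<close> or \<open>x\<^sub>l\<close>:
  two linear terms, and a rest that is \<open>o(x\<^sub>k + x\<^sub>l)\<close> near the origin. Together with compactness away
  from the origin this gives \<open>F x \<ge> c (x\<^sub>k + x\<^sub>l)\<close> on \<open>B\<close> with \<open>c > 0\<close> (\<open>power_series_ge_linear\<close>).
  Finally \<open>1 / (x\<^sub>k + x\<^sub>l)\<close> is integrable over \<open>B\<close>: two linear directions make the singularity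
  integrable, whereas \<open>1 / x\<^sub>k\<close> alone would not be (\<open>inverse_coordinate_sum_integrable\<close>).
\<close>

section \<open>Convergence and bounded multiplication in \<open>L\<^sup>2\<close>\<close>

lemma L2_eqI: "AE x in lebesgue. L2_fun u x = L2_fun v x \<Longrightarrow> u = v"
  by (simp add: L2_eq_iff)

lemma L2_fun_measurable [measurable]: "L2_fun u \<in> borel_measurable lebesgue"
  using L2_fun_square_integrable[of u] by (simp add: square_integrable_def)

lemma square_integrable_bound:
  assumes "square_integrable w" and [measurable]: "u \<in> borel_measurable lebesgue"
    and "AE x in lebesgue. \<bar>u x\<bar> \<le> \<bar>w x\<bar>"
  shows "square_integrable u"
proof -
  have "integrable lebesgue (\<lambda>x. (u x)\<^sup>2)"
  proof (rule Bochner_Integration.integrable_bound)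
    show "integrable lebesgue (\<lambda>x. (w x)\<^sup>2)"
      using assms(1) by (simp add: square_integrable_def)
    show "AE x in lebesgue. norm ((u x)\<^sup>2) \<le> norm ((w x)\<^sup>2)"
      using assms(3) by eventually_elim (simp add: abs_le_square_iff)
  qed simp
  then show ?thesis by (simp add: square_integrable_def)
qed

lemma norm_L2_square: "(norm u)\<^sup>2 = (\<integral>x. (L2_fun u x)\<^sup>2 \<partial>lebesgue)"
  unfolding power2_norm_eq_inner inner_L2_fun by (simp add: power2_eq_square)

lemma L2_tendsto_dominated:
  fixes U :: "nat \<Rightarrow> 'a::euclidean_space L2"
  assumes w: "square_integrable w"
    and bound: "\<And>n. AE x in lebesgue. \<bar>L2_fun (U n) x - L2_fun v x\<bar> \<le> w x"
    and lim: "AE x in lebesgue. (\<lambda>n. L2_fun (U n) x) \<longlonglongrightarrow> L2_fun v x"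
  shows "U \<longlonglongrightarrow> v"
proof -
  have "AE x in lebesgue. \<forall>n. L2_fun (U n - v) x = L2_fun (U n) x - L2_fun v x"
    unfolding AE_all_countable by (intro allI L2_fun_diff)
  with lim have "AE x in lebesgue. (\<lambda>n. (L2_fun (U n - v) x)\<^sup>2) \<longlonglongrightarrow> 0"
  proof eventually_elim
    case (elim x)
    have "(\<lambda>n. (L2_fun (U n) x - L2_fun v x)\<^sup>2) \<longlonglongrightarrow> (L2_fun v x - L2_fun v x)\<^sup>2"
      using elim(1) by (intro tendsto_intros)
    then show ?case using elim(2) by simp
  qed
  moreover have "AE x in lebesgue. norm ((L2_fun (U n - v) x)\<^sup>2) \<le> (w x)\<^sup>2" for n
    using bound[of n] L2_fun_diff[of "U n" v]
    by eventually_elim (metis abs_ge_zero norm_power power_mono real_norm_def)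
  ultimately have "(\<lambda>n. \<integral>x. (L2_fun (U n - v) x)\<^sup>2 \<partial>lebesgue) \<longlonglongrightarrow> (\<integral>x. 0 \<partial>(lebesgue :: 'a measure))"
    using w by (intro integral_dominated_convergence[where w = "\<lambda>x. (w x)\<^sup>2"])
      (auto simp: square_integrable_def)
  then have "(\<lambda>n. sqrt ((norm (U n - v))\<^sup>2)) \<longlonglongrightarrow> sqrt 0"
    unfolding norm_L2_square by (intro tendsto_real_sqrt) simp
  then have "(\<lambda>n. norm (U n - v)) \<longlonglongrightarrow> 0" by simp
  then show ?thesis by (rule Lim_null[THEN iffD2, OF tendsto_norm_zero_cancel])
qed

lemma L2_on_subspace: "subspace (L2_on X)"
  unfolding subspace_def L2_on_def
proof (intro conjI ballI allI)
  show "0 \<in> {u. AE x in lebesgue. x \<notin> X \<longrightarrow> L2_fun u x = 0}"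
    using L2_fun_zero by (auto elim: AE_mp)
next
  fix u v :: "'a L2"
  assume "u \<in> {u. AE x in lebesgue. x \<notin> X \<longrightarrow> L2_fun u x = 0}"
    "v \<in> {u. AE x in lebesgue. x \<notin> X \<longrightarrow> L2_fun u x = 0}"
  then have u: "AE x in lebesgue. x \<notin> X \<longrightarrow> L2_fun u x = 0"
    "AE x in lebesgue. x \<notin> X \<longrightarrow> L2_fun v x = 0" by auto
  show "u + v \<in> {u. AE x in lebesgue. x \<notin> X \<longrightarrow> L2_fun u x = 0}"
    using u L2_fun_add[of u v] unfolding mem_Collect_eq by eventually_elim auto
next
  fix u :: "'a L2" and c
  assume "u \<in> {u. AE x in lebesgue. x \<notin> X \<longrightarrow> L2_fun u x = 0}"
  then have u: "AE x in lebesgue. x \<notin> X \<longrightarrow> L2_fun u x = 0" by auto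
  show "c *\<^sub>R u \<in> {u. AE x in lebesgue. x \<notin> X \<longrightarrow> L2_fun u x = 0}"
    using u L2_fun_scaleR[of c u] unfolding mem_Collect_eq by eventually_elim auto
qed

definition bounded_multiplier :: "('a::euclidean_space \<Rightarrow> real) \<Rightarrow> bool" where
  "bounded_multiplier m \<longleftrightarrow> m \<in> borel_measurable lebesgue \<and> (\<exists>B. \<forall>x. \<bar>m x\<bar> \<le> B)"

definition multiply :: "('a::euclidean_space \<Rightarrow> real) \<Rightarrow> 'a L2 \<Rightarrow> 'a L2" where
  "multiply m u = L2_class (\<lambda>x. m x * L2_fun u x)"

lemma L2_fun_multiply:
  assumes "bounded_multiplier m"
  shows "AE x in lebesgue. L2_fun (multiply m u) x = m x * L2_fun u x"
proof -
  obtain B where B: "\<And>x. \<bar>m x\<bar> \<le> B" and [measurable]: "m \<in> borel_measurable lebesgue"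
    using assms by (auto simp: bounded_multiplier_def)
  have "square_integrable (\<lambda>x. m x * L2_fun u x)"
  proof (rule square_integrable_bound)
    show "square_integrable (\<lambda>x. B * L2_fun u x)"
      by (intro square_integrable_scale L2_fun_square_integrable)
    show "AE x in lebesgue. \<bar>m x * L2_fun u x\<bar> \<le> \<bar>B * L2_fun u x\<bar>"
      using B by (intro AE_I2) (auto simp: abs_mult intro!: mult_right_mono order_trans[OF B])
  qed simp
  then show ?thesis unfolding multiply_def by (rule L2_fun_class)
qed

lemma multiply_add:
  assumes m: "bounded_multiplier m"
  shows "multiply m (u + v) = multiply m u + multiply m v"
  by (rule L2_eqI)
    (use L2_fun_multiply[OF m, of "u + v"] L2_fun_multiply[OF m, of u] L2_fun_multiply[OF m, of v]
      L2_fun_add[of u v] L2_fun_add[of "multiply m u" "multiply m v"]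
     in eventually_elim, simp add: distrib_left)

lemma multiply_scaleR:
  assumes m: "bounded_multiplier m"
  shows "multiply m (c *\<^sub>R u) = c *\<^sub>R multiply m u"
  by (rule L2_eqI)
    (use L2_fun_multiply[OF m, of "c *\<^sub>R u"] L2_fun_multiply[OF m, of u]
      L2_fun_scaleR[of c u] L2_fun_scaleR[of c "multiply m u"]
     in eventually_elim, simp)

lemma norm_multiply_le:
  assumes m: "bounded_multiplier m" and le: "\<And>x. \<bar>m x\<bar> \<le> 1"
  shows "norm (multiply m u) \<le> norm u"
proof (rule power2_le_imp_le)
  show "(norm (multiply m u))\<^sup>2 \<le> (norm u)\<^sup>2"
    unfolding norm_L2_square
  proof (rule integral_mono_AE)
    show "AE x in lebesgue. (L2_fun (multiply m u) x)\<^sup>2 \<le> (L2_fun u x)\<^sup>2"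
      using L2_fun_multiply[OF m, of u]
    proof eventually_elim
      case (elim x)
      have "\<bar>m x\<bar> * \<bar>L2_fun u x\<bar> \<le> 1 * \<bar>L2_fun u x\<bar>" by (intro mult_right_mono le) auto
      then show ?case using elim by (simp add: abs_le_square_iff[symmetric] abs_mult)
    qed
  qed (use L2_fun_square_integrable in \<open>auto simp: square_integrable_def\<close>)
qed simp

text \<open>
  By Fatou's lemma the integral of the pointwise limit of \<open>\<bar>U n - v\<bar>\<^sup>2\<close> is at most the limit of the
  norms, which is \<open>0\<close>. This allows an \<open>L\<^sup>2\<close> limit to be computed pointwise.
\<close>

lemma L2_limit_AE_unique:
  fixes U :: "nat \<Rightarrow> 'a::euclidean_space L2"
  assumes norm_lim: "U \<longlonglongrightarrow> v"
    and lim: "AE x in lebesgue. (\<lambda>n. L2_fun (U n) x) \<longlonglongrightarrow> w x"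
  shows "AE x in lebesgue. L2_fun v x = w x"
proof -
  let ?e = "\<lambda>n x. ennreal ((L2_fun (U n - v) x)\<^sup>2)"
  have "(\<lambda>n. ennreal ((norm (U n - v))\<^sup>2)) \<longlonglongrightarrow> ennreal (0\<^sup>2)"
    using norm_lim by (intro tendsto_ennrealI tendsto_power tendsto_norm_zero) (simp add: Lim_null[symmetric])
  then have "liminf (\<lambda>n. \<integral>\<^sup>+x. ?e n x \<partial>lebesgue) = 0"
    unfolding nn_integral_L2_fun by (intro lim_imp_Liminf) auto
  moreover have "(\<integral>\<^sup>+x. liminf (\<lambda>n. ?e n x) \<partial>lebesgue) \<le> liminf (\<lambda>n. \<integral>\<^sup>+x. ?e n x \<partial>lebesgue)"
    by (rule nn_integral_liminf) measurable
  ultimately have "AE x in lebesgue. liminf (\<lambda>n. ?e n x) = 0"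
    by (subst nn_integral_0_iff_AE[symmetric]) auto
  moreover have "AE x in lebesgue. \<forall>n. L2_fun (U n - v) x = L2_fun (U n) x - L2_fun v x"
    unfolding AE_all_countable by (intro allI L2_fun_diff)
  ultimately show ?thesis
    using lim
  proof eventually_elim
    case (elim x)
    have "(\<lambda>n. ?e n x) \<longlonglongrightarrow> ennreal ((w x - L2_fun v x)\<^sup>2)"
      using elim(2,3) by (auto intro!: tendsto_intros tendsto_ennrealI)
    then have "liminf (\<lambda>n. ?e n x) = ennreal ((w x - L2_fun v x)\<^sup>2)"
      by (intro lim_imp_Liminf) auto
    with elim(1) show ?case by simp
  qed
qed

lemma L2_fun_quotient:
  "AE x in lebesgue. L2_fun ((u - v) /\<^sub>R t) x = (L2_fun u x - L2_fun v x) / t"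
  using L2_fun_scaleR[of "inverse t" "u - v"] L2_fun_diff[of u v]
  by eventually_elim (simp add: divide_inverse mult.commute)

section \<open>Semigroups with a dissipative generator\<close>

text \<open>
  Only right derivatives of semigroup orbits are elementary, so a monotonicity criterion for them is
  needed. After subtracting \<open>e s\<close> the right derivative is strictly negative; at the last time in
  \<open>[0, t]\<close> where the modified function does not exceed its initial value, it would still have to
  decrease.
\<close>

lemma right_derivative_nonpos_imp_le:
  fixes \<phi> :: "real \<Rightarrow> real"
  assumes cont: "continuous_on {0..} \<phi>"
    and deriv: "\<And>s. s \<ge> 0 \<Longrightarrow> (\<phi> has_real_derivative D s) (at_right s)"
    and D: "\<And>s. s \<ge> 0 \<Longrightarrow> D s \<le> 0" and t: "t \<ge> 0"
  shows "\<phi> t \<le> \<phi> 0"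
proof (rule field_le_epsilon)
  fix e' :: real assume "e' > 0"
  define e where "e = e' / (t + 1)"
  have e: "e > 0" using \<open>e' > 0\<close> t by (simp add: e_def)
  define \<psi> where "\<psi> s = \<phi> s - e * s - \<phi> 0" for s
  have \<psi>c: "continuous_on {0..t} \<psi>"
    unfolding \<psi>_def using cont by (intro continuous_intros continuous_on_subset[OF cont]) auto
  have "\<psi> t \<le> 0"
  proof (rule ccontr)
    assume pos: "\<not> \<psi> t \<le> 0"
    define Z where "Z = {s \<in> {0..t}. \<psi> s \<le> 0}"
    have "closed Z" unfolding Z_def
      by (intro continuous_on_closed_Collect_le \<psi>c continuous_intros)
    moreover have ne: "Z \<noteq> {}" and bdd: "bdd_above Z"
      using t by (auto simp: Z_def \<psi>_def intro!: exI[of _ 0] bdd_aboveI[of _ t])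
    ultimately have "Sup Z \<in> Z" by (intro closed_contains_Sup)
    then have s: "0 \<le> Sup Z" "Sup Z \<le> t" "\<psi> (Sup Z) \<le> 0" by (auto simp: Z_def)
    then have "Sup Z < t" using pos by (cases "Sup Z = t") auto
    have "(\<psi> has_real_derivative D (Sup Z) - e) (at_right (Sup Z))"
      unfolding \<psi>_def by (auto intro!: derivative_eq_intros deriv s)
    moreover have "D (Sup Z) - e < 0" using D[OF s(1)] e by simp
    ultimately obtain d where d: "d > 0"
      "\<And>k. k > 0 \<Longrightarrow> Sup Z + k \<in> {Sup Z<..} \<Longrightarrow> k < d \<Longrightarrow> \<psi> (Sup Z + k) < \<psi> (Sup Z)"
      using has_real_derivative_neg_dec_right[of \<psi> "D (Sup Z) - e" "Sup Z" "{Sup Z<..}"] by blast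
    define k where "k = min (d / 2) (t - Sup Z)"
    have k: "k > 0" "k < d" "Sup Z + k \<le> t" using d \<open>Sup Z < t\<close> by (auto simp: k_def)
    then have "\<psi> (Sup Z + k) \<le> 0" using d(2)[of k] s by auto
    then have "Sup Z + k \<in> Z" using k s by (auto simp: Z_def)
    then have "Sup Z + k \<le> Sup Z" using bdd by (rule cSup_upper)
    then show False using k by simp
  qed
  then have "\<phi> t \<le> \<phi> 0 + e * t" by (simp add: \<psi>_def)
  also have "e * t \<le> e'" using \<open>e' > 0\<close> t by (simp add: e_def field_simps)
  finally show "\<phi> t \<le> \<phi> 0 + e'" by simp
qed

lemma C0_semigroup_diff:
  assumes S: "C0_semigroup H S" and H: "subspace H" and "t \<ge> 0" "u \<in> H" "v \<in> H"
  shows "S t (u - v) = S t u - S t v"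
proof -
  have "(-1) *\<^sub>R v \<in> H" using H \<open>v \<in> H\<close> by (rule subspace_scale)
  then have "S t (u + (-1) *\<^sub>R v) = S t u + (-1) *\<^sub>R S t v"
    using assms unfolding C0_semigroup_def by metis
  then show ?thesis by simp
qed

text \<open>
  The difference quotient of the orbit through \<open>S s u\<close> is the image under the bounded operator \<open>S s\<close>
  of the difference quotient at \<open>u\<close>.
\<close>

lemma generator_invariant:
  assumes S: "C0_semigroup H S" and H: "subspace H"
    and uv: "(u, v) \<in> generator H S" and s: "s \<ge> 0"
  shows "(S s u, S s v) \<in> generator H S"
proof -
  have uH: "u \<in> H" "v \<in> H" and lim: "((\<lambda>t. (S t u - u) /\<^sub>R t) \<longlongrightarrow> v) (at_right 0)"
    using uv by (auto simp: generator_def)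
  have SH: "S t w \<in> H" if "t \<ge> 0" "w \<in> H" for t w
    using S that by (auto simp: C0_semigroup_def)
  obtain B where B: "\<And>w. w \<in> H \<Longrightarrow> norm (S s w) \<le> B * norm w"
    using S s unfolding C0_semigroup_def by metis
  have quot: "(S t u - u) /\<^sub>R t \<in> H" if "t > 0" for t
    using that uH SH by (intro subspace_scale subspace_diff H) auto
  have eq: "(S t (S s u) - S s u) /\<^sub>R t = S s ((S t u - u) /\<^sub>R t)" if t: "t > 0" for t
  proof -
    have "S t (S s u) = S s (S t u)"
      using S s t uH unfolding C0_semigroup_def by (metis add.commute less_imp_le)
    then have "S t (S s u) - S s u = S s (S t u - u)"
      using C0_semigroup_diff[OF S H s SH uH(1), of t u] t uH by simp
    moreover have "S t u - u \<in> H" using H uH SH t by (intro subspace_diff) auto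
    ultimately show ?thesis
      using S s unfolding C0_semigroup_def by metis
  qed
  have "((\<lambda>t. S s ((S t u - u) /\<^sub>R t)) \<longlongrightarrow> S s v) (at_right 0)"
  proof (rule Lim_null[THEN iffD2], rule Lim_null_comparison)
    show "\<forall>\<^sub>F t in at_right 0. norm (S s ((S t u - u) /\<^sub>R t) - S s v) \<le> B * norm ((S t u - u) /\<^sub>R t - v)"
      unfolding eventually_at_right_field
    proof (intro exI[of _ 1] conjI allI impI)
      fix t :: real assume "t > 0"
      then show "norm (S s ((S t u - u) /\<^sub>R t) - S s v) \<le> B * norm ((S t u - u) /\<^sub>R t - v)"
        using C0_semigroup_diff[OF S H s quot uH(2), of t] B[of "(S t u - u) /\<^sub>R t - v"]
          subspace_diff[OF H quot uH(2), of t] by simp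
    qed simp
    have "((\<lambda>t. norm ((S t u - u) /\<^sub>R t - v)) \<longlongrightarrow> 0) (at_right 0)"
      using lim by (intro tendsto_norm_zero) (simp add: Lim_null[symmetric])
    then show "((\<lambda>t. B * norm ((S t u - u) /\<^sub>R t - v)) \<longlongrightarrow> 0) (at_right 0)"
      by (rule tendsto_mult_right_zero)
  qed
  then have "((\<lambda>t. (S t (S s u) - S s u) /\<^sub>R t) \<longlongrightarrow> S s v) (at_right 0)"
    by (rule Lim_transform_eventually) (auto simp: eventually_at_right_field eq intro!: exI[of _ 1])
  then show ?thesis using SH uH s by (simp add: generator_def)
qed

lemma has_vector_derivative_if_quotient_tendsto:
  fixes F :: "real \<Rightarrow> 'b::real_normed_vector"
  assumes "((\<lambda>t. (F t - F s) /\<^sub>R (t - s)) \<longlongrightarrow> D) (at s within S)"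
  shows "(F has_vector_derivative D) (at s within S)"
proof -
  have "((\<lambda>t. norm ((F t - F s) /\<^sub>R (t - s) - D)) \<longlongrightarrow> 0) (at s within S)"
    using assms by (intro tendsto_norm_zero) (simp add: Lim_null[symmetric])
  then have "((\<lambda>t. norm (F t - F s - (t - s) *\<^sub>R D) / norm (t - s)) \<longlongrightarrow> 0) (at s within S)"
  proof (rule Lim_transform_eventually)
    have "norm ((F t - F s) /\<^sub>R (t - s) - D) = norm (F t - F s - (t - s) *\<^sub>R D) / norm (t - s)"
      if "t \<noteq> s" for t
    proof -
      have "(F t - F s) /\<^sub>R (t - s) - D = (F t - F s - (t - s) *\<^sub>R D) /\<^sub>R (t - s)"
        using that by (simp add: scaleR_diff_right)
      then show ?thesis by (simp add: divide_inverse mult.commute)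
    qed
    then show "\<forall>\<^sub>F t in at s within S. norm ((F t - F s) /\<^sub>R (t - s) - D)
        = norm (F t - F s - (t - s) *\<^sub>R D) / norm (t - s)"
      by (auto simp: eventually_at_filter)
  qed
  then show ?thesis
    unfolding has_vector_derivative_def has_derivative_iff_norm
    by (auto intro!: bounded_linear_scaleR_left)
qed

lemma orbit_right_derivative:
  assumes S: "C0_semigroup H S" and H: "subspace H"
    and uv: "(u, v) \<in> generator H S" and s: "s \<ge> 0"
  shows "((\<lambda>t. S t u) has_vector_derivative S s v) (at_right s)"
proof -
  have uH: "u \<in> H" using uv by (auto simp: generator_def)
  have "((\<lambda>t. (S t (S s u) - S s u) /\<^sub>R t) \<longlongrightarrow> S s v) (at_right 0)"
    using generator_invariant[OF assms] by (simp add: generator_def)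
  then have "((\<lambda>t. (S (t + s) u - S s u) /\<^sub>R t) \<longlongrightarrow> S s v) (at_right 0)"
    by (rule Lim_transform_eventually)
      (use S s uH in \<open>auto simp: eventually_at_right_field C0_semigroup_def intro!: exI[of _ 1]\<close>)
  then have "((\<lambda>t. (S t u - S s u) /\<^sub>R (t - s)) \<longlongrightarrow> S s v) (at_right s)"
    by (subst at_right_to_0) (simp add: filterlim_filtermap)
  then show ?thesis by (rule has_vector_derivative_if_quotient_tendsto)
qed

text \<open>
  The orbits \<open>x\<close> and \<open>y\<close> of \<open>u\<close> under the two semigroups stay in the domain of the common generator
  \<open>A\<close>. Their squared distance starts at \<open>0\<close> and has right derivative \<open>2 \<langle>x - y, A x - A y\<rangle> \<le> 0\<close>.
\<close>

lemma generator_determines_orbit: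
  fixes H :: "'h::real_inner set"
  assumes S: "C0_semigroup H S" and T: "C0_semigroup H T" and H: "subspace H"
    and gen: "generator H S = generator H T"
    and dissip: "\<And>u v u' v'. (u, v) \<in> generator H T \<Longrightarrow> (u', v') \<in> generator H T \<Longrightarrow>
      inner (u - u') (v - v') \<le> 0"
    and uv: "(u, v) \<in> generator H T" and t: "t \<ge> 0"
  shows "S t u = T t u"
proof -
  have uH: "u \<in> H" using uv by (auto simp: generator_def)
  have "(norm (S t u - T t u))\<^sup>2 \<le> (norm (S 0 u - T 0 u))\<^sup>2"
  proof (rule right_derivative_nonpos_imp_le[where \<phi> = "\<lambda>s. (norm (S s u - T s u))\<^sup>2"
        and D = "\<lambda>s. 2 * inner (S s u - T s u) (S s v - T s v)"])
    show "continuous_on {0..} (\<lambda>s. (norm (S s u - T s u))\<^sup>2)"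
      using S T uH by (intro continuous_intros) (auto simp: C0_semigroup_def)
  next
    fix s :: real assume s: "s \<ge> 0"
    have "((\<lambda>s. S s u - T s u) has_vector_derivative S s v - T s v) (at_right s)"
      using uv gen by (intro has_vector_derivative_diff orbit_right_derivative[OF S H]
          orbit_right_derivative[OF T H] s) auto
    then have "((\<lambda>s. inner (S s u - T s u) (S s u - T s u)) has_derivative
        (\<lambda>h. inner (S s u - T s u) (h *\<^sub>R (S s v - T s v)) +
             inner (h *\<^sub>R (S s v - T s v)) (S s u - T s u))) (at_right s)"
      unfolding has_vector_derivative_def by (intro has_derivative_inner)
    then show "((\<lambda>s. (norm (S s u - T s u))\<^sup>2) has_real_derivative
        2 * inner (S s u - T s u) (S s v - T s v)) (at_right s)"
      unfolding has_field_derivative_def power2_norm_eq_inner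
      by (rule has_derivative_eq_rhs) (auto simp: inner_commute)
    show "2 * inner (S s u - T s u) (S s v - T s v) \<le> 0"
      using dissip generator_invariant[OF S H _ s, of u v] generator_invariant[OF T H uv s] uv gen
      by fastforce
  qed (use t in auto)
  also have "S 0 u = T 0 u" using S T uH by (simp add: C0_semigroup_def)
  finally show ?thesis by simp
qed

lemma semigroup_exp_eqI:
  fixes H :: "'h::real_inner set"
  assumes T: "C0_semigroup H T" and H: "subspace H" and gen: "generator H T = A"
    and dissip: "\<And>u v u' v'. (u, v) \<in> A \<Longrightarrow> (u', v') \<in> A \<Longrightarrow> inner (u - u') (v - v') \<le> 0"
    and uv: "(u, v) \<in> A" and t: "t \<ge> 0"
  shows "semigroup_exp H A t u = T t u"
  unfolding semigroup_exp_def
proof (rule the_equality)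
  show "\<exists>S. C0_semigroup H S \<and> generator H S = A \<and> T t u = S t u"
    using T gen by blast
next
  fix w assume "\<exists>S. C0_semigroup H S \<and> generator H S = A \<and> w = S t u"
  then show "w = T t u"
    using generator_determines_orbit[OF _ T H, of _ u v t] gen dissip uv t by auto
qed

section \<open>The semigroup of a nonpositive multiplier\<close>

lemma abs_exp_diff_le:
  fixes a b :: real
  assumes "a \<le> 0" "b \<le> 0"
  shows "\<bar>exp a - exp b\<bar> \<le> \<bar>a - b\<bar>"
proof -
  have *: "exp b - exp a \<le> b - a" if "a \<le> b" "b \<le> 0" for a b :: real
  proof -
    have "exp b - exp a = exp b * (1 - exp (a - b))" by (simp add: algebra_simps exp_diff)
    also have "\<dots> \<le> 1 * (1 - exp (a - b))" using that by (intro mult_right_mono) auto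
    also have "\<dots> \<le> b - a" unfolding mult_1 using exp_ge_add_one_self[of "a - b"] by linarith
    finally show ?thesis .
  qed
  show ?thesis using *[of a b] *[of b a] assms by (cases "a \<le> b") auto
qed

lemma exp_quotient_tendsto:
  fixes c s :: real
  assumes "\<And>n. \<tau> n \<noteq> s" and "\<tau> \<longlonglongrightarrow> s"
  shows "(\<lambda>n. (exp (\<tau> n * c) - exp (s * c)) / (\<tau> n - s)) \<longlonglongrightarrow> c * exp (s * c)"
proof -
  have "((\<lambda>t. exp (t * c)) has_real_derivative c * exp (s * c)) (at s)"
    by (auto intro!: derivative_eq_intros)
  then have "((\<lambda>t. (exp (t * c) - exp (s * c)) / (t - s)) \<longlongrightarrow> c * exp (s * c)) (at s)"
    by (simp add: has_field_derivative_iff)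
  then show ?thesis
    unfolding tendsto_at_iff_sequentially comp_def using assms by auto
qed

lemma square_integrable_indicator:
  assumes "B \<in> lmeasurable"
  shows "square_integrable (indicator B)"
proof -
  have "(\<lambda>x. (indicator B x :: real)\<^sup>2) = indicator B" by (auto simp: indicator_def)
  then show ?thesis using assms by (simp add: square_integrable_def lmeasurable_iff_integrable)
qed

text \<open>
  The values of \<open>h\<close> outside \<open>X\<close> are arbitrary, so measurability is asked of the extension by zero.
\<close>

locale dissipative_multiplier =
  fixes X :: "'a::euclidean_space set" and h :: "'a \<Rightarrow> real"
  assumes X_sets [measurable]: "X \<in> sets lebesgue"
    and h_measurable [measurable]: "(\<lambda>x. indicator X x * h x) \<in> borel_measurable lebesgue"
    and h_nonpos: "\<And>x. x \<in> X \<Longrightarrow> h x \<le> 0"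
begin

text \<open>
  Inside the factor \<open>indicator X x\<close>, the function \<open>h\<close> may be replaced by its extension by zero.
\<close>

lemma measurable_comp_h:
  assumes [measurable]: "F \<in> borel_measurable borel"
  shows "(\<lambda>x. indicator X x * F (h x) :: real) \<in> borel_measurable lebesgue"
proof -
  have "(\<lambda>x. indicator X x * F (indicator X x * h x) :: real) \<in> borel_measurable lebesgue"
    by measurable
  also have "(\<lambda>x. indicator X x * F (indicator X x * h x)) = (\<lambda>x. indicator X x * F (h x))"
    by (auto simp: indicator_def)
  finally show ?thesis .
qed

definition flow :: "real \<Rightarrow> 'a L2 \<Rightarrow> 'a L2" where
  "flow t = multiply (\<lambda>x. indicator X x * exp (t * h x))"

lemma exp_h_le_1: "t \<ge> 0 \<Longrightarrow> x \<in> X \<Longrightarrow> exp (t * h x) \<le> 1"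
  using h_nonpos by (simp add: mult_nonneg_nonpos)

lemma flow_multiplier_bound: "t \<ge> 0 \<Longrightarrow> \<bar>indicator X x * exp (t * h x)\<bar> \<le> 1"
  using exp_h_le_1 by (auto simp: indicator_def)

lemma flow_multiplier: "t \<ge> 0 \<Longrightarrow> bounded_multiplier (\<lambda>x. indicator X x * exp (t * h x))"
  unfolding bounded_multiplier_def
  using flow_multiplier_bound measurable_comp_h[of "\<lambda>y. exp (t * y)"] by fastforce

lemma L2_fun_flow:
  "t \<ge> 0 \<Longrightarrow> AE x in lebesgue. L2_fun (flow t u) x = indicator X x * exp (t * h x) * L2_fun u x"
  unfolding flow_def by (intro L2_fun_multiply flow_multiplier)

lemma flow_in_L2_on: "t \<ge> 0 \<Longrightarrow> flow t u \<in> L2_on X"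
  using L2_fun_flow[of t u] unfolding L2_on_def mem_Collect_eq by (auto elim!: AE_mp)

lemma flow_flow:
  assumes "s \<ge> 0" "t \<ge> 0"
  shows "flow s (flow t u) = flow (s + t) u"
proof (rule L2_eqI)
  show "AE x in lebesgue. L2_fun (flow s (flow t u)) x = L2_fun (flow (s + t) u) x"
    using L2_fun_flow[OF assms(1), of "flow t u"] L2_fun_flow[OF assms(2), of u]
      L2_fun_flow[OF add_nonneg_nonneg[OF assms], of u]
    by eventually_elim (auto simp: indicator_def distrib_right exp_add)
qed

text \<open>
  Pointwise continuity of \<open>exp (t h)\<close>, with \<open>2 \<bar>u\<bar>\<close> as dominating function.
\<close>

lemma flow_continuous: "continuous_on {0..} (\<lambda>t. flow t u)"
  unfolding continuous_on_def
proof
  fix s :: real assume "s \<in> {0..}"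
  then have s: "s \<ge> 0" by simp
  show "((\<lambda>t. flow t u) \<longlongrightarrow> flow s u) (at s within {0..})"
    unfolding tendsto_at_iff_sequentially comp_def
  proof (intro allI impI)
    fix \<tau> :: "nat \<Rightarrow> real" assume "\<forall>i. \<tau> i \<in> {0..} - {s}" and lim: "\<tau> \<longlonglongrightarrow> s"
    then have \<tau>: "\<And>n. \<tau> n \<ge> 0" by auto
    have ae: "AE x in lebesgue. \<forall>n. L2_fun (flow (\<tau> n) u) x = indicator X x * exp (\<tau> n * h x) * L2_fun u x"
      unfolding AE_all_countable by (intro allI L2_fun_flow \<tau>)
    show "(\<lambda>n. flow (\<tau> n) u) \<longlonglongrightarrow> flow s u"
    proof (rule L2_tendsto_dominated)
      show "square_integrable (\<lambda>x. 2 * \<bar>L2_fun u x\<bar>)"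
        by (intro square_integrable_scale square_integrable_bound[OF L2_fun_square_integrable[of u]]) auto
      fix n
      show "AE x in lebesgue. \<bar>L2_fun (flow (\<tau> n) u) x - L2_fun (flow s u) x\<bar> \<le> 2 * \<bar>L2_fun u x\<bar>"
        using ae L2_fun_flow[OF s, of u]
      proof eventually_elim
        case (elim x)
        let ?m = "\<lambda>t. indicator X x * exp (t * h x)"
        have "\<bar>L2_fun (flow (\<tau> n) u) x - L2_fun (flow s u) x\<bar> = \<bar>?m (\<tau> n) - ?m s\<bar> * \<bar>L2_fun u x\<bar>"
          using elim by (simp add: abs_mult[symmetric] left_diff_distrib)
        also have "\<dots> \<le> 2 * \<bar>L2_fun u x\<bar>"
          using flow_multiplier_bound[OF \<tau>[of n], of x] flow_multiplier_bound[OF s, of x]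
          by (intro mult_right_mono) linarith+
        finally show ?case .
      qed
    next
      show "AE x in lebesgue. (\<lambda>n. L2_fun (flow (\<tau> n) u) x) \<longlonglongrightarrow> L2_fun (flow s u) x"
        using ae L2_fun_flow[OF s, of u]
        by eventually_elim (auto intro!: tendsto_intros lim)
    qed
  qed
qed

lemma flow_C0_semigroup: "C0_semigroup (L2_on X) flow"
  unfolding C0_semigroup_def
proof (intro conjI allI impI ballI)
  fix t :: real assume t: "t \<ge> 0"
  show "flow t u \<in> L2_on X" for u by (rule flow_in_L2_on[OF t])
  show "flow t (u + v) = flow t u + flow t v" for u v
    unfolding flow_def by (rule multiply_add[OF flow_multiplier[OF t]])
  show "flow t (c *\<^sub>R u) = c *\<^sub>R flow t u" for c u
    unfolding flow_def by (rule multiply_scaleR[OF flow_multiplier[OF t]])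
  show "\<exists>B. \<forall>u\<in>L2_on X. norm (flow t u) \<le> B * norm u"
    using norm_multiply_le[OF flow_multiplier[OF t] flow_multiplier_bound[OF t]]
    by (intro exI[of _ 1]) (simp add: flow_def)
next
  fix u assume "u \<in> L2_on X"
  then have "AE x in lebesgue. x \<notin> X \<longrightarrow> L2_fun u x = 0" by (simp add: L2_on_def)
  then have "AE x in lebesgue. L2_fun (flow 0 u) x = L2_fun u x"
    using L2_fun_flow[OF order_refl, of u] by eventually_elim (auto simp: indicator_def)
  then show "flow 0 u = u" by (rule L2_eqI)
qed (simp_all add: flow_flow flow_continuous)

lemma flow_quotient_AE:
  assumes u: "u \<in> L2_on X" and \<tau>: "\<And>n :: nat. \<tau> n > 0"
  shows "AE x in lebesgue. \<forall>n. L2_fun ((flow (\<tau> n) u - u) /\<^sub>R \<tau> n) x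
      = indicator X x * ((exp (\<tau> n * h x) - 1) / \<tau> n) * L2_fun u x"
  unfolding AE_all_countable
proof
  fix n
  have "AE x in lebesgue. x \<notin> X \<longrightarrow> L2_fun u x = 0" using u by (simp add: L2_on_def)
  then show "AE x in lebesgue. L2_fun ((flow (\<tau> n) u - u) /\<^sub>R \<tau> n) x
      = indicator X x * ((exp (\<tau> n * h x) - 1) / \<tau> n) * L2_fun u x"
    using L2_fun_quotient[where u = "flow (\<tau> n) u" and v = u and t = "\<tau> n"]
      L2_fun_flow[OF less_imp_le[OF \<tau>[of n]], of u]
    by eventually_elim (auto simp: indicator_def left_diff_distrib)
qed

lemma flow_quotient_tendsto_AE:
  assumes u: "u \<in> L2_on X" and \<tau>: "\<And>n :: nat. \<tau> n > 0" and lim: "\<tau> \<longlonglongrightarrow> 0"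
  shows "AE x in lebesgue. (\<lambda>n. L2_fun ((flow (\<tau> n) u - u) /\<^sub>R \<tau> n) x)
      \<longlonglongrightarrow> indicator X x * h x * L2_fun u x"
  using flow_quotient_AE[OF u, of \<tau>, OF \<tau>]
proof eventually_elim
  case (elim x)
  have "(\<lambda>n. (exp (\<tau> n * h x) - 1) / \<tau> n) \<longlonglongrightarrow> h x"
    using exp_quotient_tendsto[of \<tau> 0 "h x"] \<tau> lim by (simp add: less_imp_neq[symmetric])
  then have "(\<lambda>n. indicator X x * ((exp (\<tau> n * h x) - 1) / \<tau> n) * L2_fun u x)
      \<longlonglongrightarrow> indicator X x * h x * L2_fun u x"
    by (intro tendsto_mult tendsto_const)
  then show ?case by (simp only: elim)
qed

text \<open>
  If the difference quotients converge in \<open>L\<^sup>2\<close>, their limit must be the pointwise limit \<open>h u\<close>.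
  Conversely, if \<open>h u\<close> is square integrable then it dominates the quotients, since
  \<open>\<bar>exp (t h) - 1\<bar> \<le> t \<bar>h\<bar>\<close> for \<open>h \<le> 0\<close>.
\<close>

lemma generator_flow: "generator (L2_on X) flow = mult_op X h"
proof (intro set_eqI iffI; clarify)
  fix u v assume "(u, v) \<in> generator (L2_on X) flow"
  then have uv: "u \<in> L2_on X" "v \<in> L2_on X"
    and lim: "((\<lambda>t. (flow t u - u) /\<^sub>R t) \<longlongrightarrow> v) (at_right 0)"
    by (auto simp: generator_def)
  define \<tau> where "\<tau> n = 1 / real (Suc n)" for n
  have \<tau>: "\<tau> n > 0" "\<tau> \<longlonglongrightarrow> 0" for n
    unfolding \<tau>_def using LIMSEQ_Suc[OF lim_1_over_n] by (auto simp: o_def)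
  have "(\<lambda>n. (flow (\<tau> n) u - u) /\<^sub>R \<tau> n) \<longlonglongrightarrow> v"
    using lim \<tau> unfolding tendsto_at_iff_sequentially comp_def by force
  then have "AE x in lebesgue. L2_fun v x = indicator X x * h x * L2_fun u x"
    by (rule L2_limit_AE_unique[OF _ flow_quotient_tendsto_AE[OF uv(1) \<tau>]])
  then have "AE x in lebesgue. x \<in> X \<longrightarrow> L2_fun v x = h x * L2_fun u x"
    by eventually_elim auto
  with uv show "(u, v) \<in> mult_op X h" by (simp add: mult_op_def)
next
  fix u v assume "(u, v) \<in> mult_op X h"
  then have uv: "u \<in> L2_on X" "v \<in> L2_on X"
    and v: "AE x in lebesgue. x \<in> X \<longrightarrow> L2_fun v x = h x * L2_fun u x"
    by (auto simp: mult_op_def)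
  then have "AE x in lebesgue. x \<notin> X \<longrightarrow> L2_fun v x = 0" by (simp add: L2_on_def)
  with v have hu: "AE x in lebesgue. indicator X x * h x * L2_fun u x = L2_fun v x"
    by eventually_elim (auto simp: indicator_def)
  have "((\<lambda>t. (flow t u - u) /\<^sub>R t) \<longlongrightarrow> v) (at_right 0)"
    unfolding tendsto_at_iff_sequentially comp_def
  proof (intro allI impI)
    fix \<tau> :: "nat \<Rightarrow> real" assume "\<forall>i. \<tau> i \<in> {0<..} - {0}" and lim: "\<tau> \<longlonglongrightarrow> 0"
    then have \<tau>: "\<And>n. \<tau> n > 0" by auto
    show "(\<lambda>n. (flow (\<tau> n) u - u) /\<^sub>R \<tau> n) \<longlonglongrightarrow> v"
    proof (rule L2_tendsto_dominated)
      show "square_integrable (\<lambda>x. 2 * \<bar>L2_fun v x\<bar>)"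
        by (intro square_integrable_scale square_integrable_bound[OF L2_fun_square_integrable[of v]]) auto
      fix n
      show "AE x in lebesgue. \<bar>L2_fun ((flow (\<tau> n) u - u) /\<^sub>R \<tau> n) x - L2_fun v x\<bar> \<le> 2 * \<bar>L2_fun v x\<bar>"
        using flow_quotient_AE[OF uv(1), of \<tau>, OF \<tau>] hu
      proof eventually_elim
        case (elim x)
        have "\<bar>L2_fun ((flow (\<tau> n) u - u) /\<^sub>R \<tau> n) x\<bar> \<le> \<bar>L2_fun v x\<bar>"
        proof (cases "x \<in> X")
          case True
          have "\<bar>(exp (\<tau> n * h x) - 1) / \<tau> n\<bar> \<le> \<bar>h x\<bar>"
            using abs_exp_diff_le[of "\<tau> n * h x" 0] \<tau>[of n] h_nonpos[OF True]
            by (simp add: mult_nonneg_nonpos abs_mult field_simps)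
          then have "\<bar>(exp (\<tau> n * h x) - 1) / \<tau> n\<bar> * \<bar>L2_fun u x\<bar> \<le> \<bar>h x\<bar> * \<bar>L2_fun u x\<bar>"
            by (intro mult_right_mono) auto
          then show ?thesis using True elim by (simp add: abs_mult)
        qed (use elim in simp)
        then show ?case by linarith
      qed
    next
      show "AE x in lebesgue. (\<lambda>n. L2_fun ((flow (\<tau> n) u - u) /\<^sub>R \<tau> n) x) \<longlonglongrightarrow> L2_fun v x"
        using flow_quotient_tendsto_AE[OF uv(1), of \<tau>, OF \<tau> lim] hu by eventually_elim simp
    qed
  qed
  with uv show "(u, v) \<in> generator (L2_on X) flow" by (simp add: generator_def)
qed

lemma mult_op_dissipative:
  assumes "(u, v) \<in> mult_op X h" "(u', v') \<in> mult_op X h"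
  shows "inner (u - u') (v - v') \<le> 0"
proof -
  have "AE x in lebesgue. L2_fun (u - u') x * L2_fun (v - v') x \<le> 0"
  proof -
    have "AE x in lebesgue. x \<in> X \<longrightarrow> L2_fun v x = h x * L2_fun u x"
      "AE x in lebesgue. x \<in> X \<longrightarrow> L2_fun v' x = h x * L2_fun u' x"
      "AE x in lebesgue. x \<notin> X \<longrightarrow> L2_fun u x = 0" "AE x in lebesgue. x \<notin> X \<longrightarrow> L2_fun u' x = 0"
      using assms by (auto simp: mult_op_def L2_on_def)
    then show ?thesis using L2_fun_diff[of u u'] L2_fun_diff[of v v']
    proof eventually_elim
      case (elim x)
      show ?case
      proof (cases "x \<in> X")
        case True
        then have "L2_fun (u - u') x * L2_fun (v - v') x = h x * (L2_fun u x - L2_fun u' x)\<^sup>2"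
          unfolding elim(5,6) using elim(1,2) by (simp add: power2_eq_square algebra_simps)
        then show ?thesis using h_nonpos[OF True] by (simp add: mult_nonpos_nonneg)
      qed (use elim in simp)
    qed
  qed
  then have "0 \<le> (\<integral>x. - (L2_fun (u - u') x * L2_fun (v - v') x) \<partial>lebesgue)"
    by (intro integral_nonneg_AE) auto
  then show ?thesis by (simp add: inner_L2_fun)
qed

text \<open>
  On the domain of the generator, uniqueness of the orbit determines the definite description behind
  \<open>semigroup_exp\<close>.
\<close>

lemma semigroup_exp_mult_op:
  assumes "(u, v) \<in> mult_op X h" and "t \<ge> 0"
  shows "semigroup_exp (L2_on X) (mult_op X h) t u = flow t u"
  by (rule semigroup_exp_eqI[OF flow_C0_semigroup L2_on_subspace generator_flow mult_op_dissipative assms])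

lemma semigroup_exp_twice_mult_op:
  assumes uv: "(u, v) \<in> mult_op X h" and t: "t \<ge> 0"
  shows "semigroup_exp (L2_on X) (mult_op X h) t (semigroup_exp (L2_on X) (mult_op X h) t u)
    = flow (2 * t) u"
proof -
  have "(flow t u, flow t v) \<in> mult_op X h"
    using generator_invariant[OF flow_C0_semigroup L2_on_subspace _ t] uv
    by (simp add: generator_flow)
  from semigroup_exp_mult_op[OF this t] show ?thesis
    using semigroup_exp_mult_op[OF uv t] flow_flow[OF t t, of u] by simp
qed

lemma indicator_in_mult_op:
  assumes B: "B \<in> lmeasurable" "B \<subseteq> X" and bdd: "bounded (h ` B)"
  shows "(L2_class (indicator B), L2_class (\<lambda>x. indicator B x * h x)) \<in> mult_op X h"
proof -
  have [measurable]: "B \<in> sets lebesgue" using B by (simp add: fmeasurable_def)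
  have sB: "square_integrable (indicator B :: 'a \<Rightarrow> real)"
    by (rule square_integrable_indicator[OF B(1)])
  obtain C where C: "\<And>x. x \<in> B \<Longrightarrow> \<bar>h x\<bar> \<le> C" using bdd by (auto simp: bounded_iff)
  have shB: "square_integrable (\<lambda>x. indicator B x * h x)"
  proof (rule square_integrable_bound)
    show "square_integrable (\<lambda>x. C * indicator B x :: real)" by (intro square_integrable_scale sB)
    have "(\<lambda>x. indicator B x * (indicator X x * h x)) \<in> borel_measurable lebesgue" by measurable
    also have "(\<lambda>x. indicator B x * (indicator X x * h x)) = (\<lambda>x. indicator B x * h x)"
      using B by (auto simp: indicator_def fun_eq_iff)
    finally show "(\<lambda>x. indicator B x * h x) \<in> borel_measurable lebesgue" .
    show "AE x in lebesgue. \<bar>indicator B x * h x\<bar> \<le> \<bar>C * indicator B x\<bar>"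
      using C by (intro AE_I2) (fastforce simp: indicator_def)
  qed
  have u: "AE x in lebesgue. L2_fun (L2_class (indicator B)) x = indicator B x"
    by (rule L2_fun_class[OF sB])
  note v = L2_fun_class[OF shB]
  have "AE x in lebesgue. x \<notin> X \<longrightarrow> L2_fun (L2_class (indicator B)) x = 0"
    using u by eventually_elim (use B in \<open>auto simp: indicator_def\<close>)
  moreover have "AE x in lebesgue. x \<notin> X \<longrightarrow> L2_fun (L2_class (\<lambda>x. indicator B x * h x)) x = 0"
    using v by eventually_elim (use B in \<open>auto simp: indicator_def\<close>)
  moreover have "AE x in lebesgue. x \<in> X \<longrightarrow>
      L2_fun (L2_class (\<lambda>x. indicator B x * h x)) x = h x * L2_fun (L2_class (indicator B)) x"
    using u v by eventually_elim simp
  ultimately show ?thesis by (simp add: mult_op_def L2_on_def)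
qed

end

section \<open>The asymptotic covariance operator\<close>

locale strictly_dissipative_multiplier = dissipative_multiplier +
  fixes p :: real
  assumes p_neg: "p < 0" and h_le_p: "\<And>x. x \<in> X \<Longrightarrow> h x \<le> p"
begin

text \<open>
  The factor \<open>2\<close> comes from the two semigroup factors in the covariance integrand; the division by
  \<open>2 h\<close> gives a bounded multiplier because \<open>h\<close> stays below \<open>p < 0\<close>.
\<close>

definition antiderivative :: "real \<Rightarrow> 'a L2 \<Rightarrow> 'a L2" where
  "antiderivative t = multiply (\<lambda>x. indicator X x * (exp (t * (2 * h x)) / (2 * h x)))"

lemma antiderivative_multiplier_bound:
  assumes "t \<ge> 0"
  shows "\<bar>indicator X x * (exp (t * (2 * h x)) / (2 * h x))\<bar> \<le> 1 / \<bar>2 * p\<bar>"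
proof (cases "x \<in> X")
  case True
  have "\<bar>exp (t * (2 * h x))\<bar> / \<bar>2 * h x\<bar> \<le> 1 / \<bar>2 * p\<bar>"
    using exp_h_le_1[OF _ True, of "2 * t"] assms h_le_p[OF True] p_neg
    by (intro frac_le) (auto simp: mult_ac)
  then show ?thesis using True by (simp add: abs_divide)
qed simp

lemma antiderivative_multiplier:
  assumes "t \<ge> 0"
  shows "bounded_multiplier (\<lambda>x. indicator X x * (exp (t * (2 * h x)) / (2 * h x)))"
  unfolding bounded_multiplier_def
  using antiderivative_multiplier_bound[OF assms] measurable_comp_h[of "\<lambda>y. exp (t * (2 * y)) / (2 * y)"]
  by fastforce

lemma L2_fun_antiderivative:
  assumes "t \<ge> 0"
  shows "AE x in lebesgue. L2_fun (antiderivative t u) x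
    = indicator X x * (exp (t * (2 * h x)) / (2 * h x)) * L2_fun u x"
  unfolding antiderivative_def by (intro L2_fun_multiply antiderivative_multiplier assms)

text \<open>
  The derivative is computed pointwise. The difference quotients of the multiplier are bounded by \<open>1\<close>,
  since \<open>exp\<close> is \<open>1\<close>-Lipschitz on the nonpositive half-line.
\<close>

lemma antiderivative_has_derivative:
  assumes s: "s \<in> {0..t}"
  shows "((\<lambda>s. antiderivative s u) has_vector_derivative flow (2 * s) u) (at s within {0..t})"
proof (rule has_vector_derivative_if_quotient_tendsto,
    unfold tendsto_at_iff_sequentially comp_def, intro allI impI)
  fix \<tau> :: "nat \<Rightarrow> real" assume "\<forall>i. \<tau> i \<in> {0..t} - {s}" and lim: "\<tau> \<longlonglongrightarrow> s"
  then have \<tau>: "\<And>n. \<tau> n \<ge> 0" "\<And>n. \<tau> n \<noteq> s" by auto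
  let ?q = "\<lambda>n x. ((exp (\<tau> n * (2 * h x)) - exp (s * (2 * h x))) / (\<tau> n - s)) / (2 * h x)"
  have ae: "AE x in lebesgue. \<forall>n. L2_fun ((antiderivative (\<tau> n) u - antiderivative s u) /\<^sub>R (\<tau> n - s)) x
      = indicator X x * ?q n x * L2_fun u x"
    unfolding AE_all_countable
  proof
    fix n
    have "s \<ge> 0" using s by simp
    show "AE x in lebesgue. L2_fun ((antiderivative (\<tau> n) u - antiderivative s u) /\<^sub>R (\<tau> n - s)) x
      = indicator X x * ?q n x * L2_fun u x"
      using L2_fun_antiderivative[OF \<open>s \<ge> 0\<close>, of u] L2_fun_antiderivative[OF \<tau>(1)[of n], of u]
        L2_fun_quotient[where u = "antiderivative (\<tau> n) u" and v = "antiderivative s u" and t = "\<tau> n - s"]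
      by eventually_elim (auto simp: indicator_def diff_divide_distrib algebra_simps)
  qed
  have fl: "AE x in lebesgue. L2_fun (flow (2 * s) u) x = indicator X x * exp (2 * s * h x) * L2_fun u x"
    using s by (intro L2_fun_flow) auto
  show "(\<lambda>n. (antiderivative (\<tau> n) u - antiderivative s u) /\<^sub>R (\<tau> n - s)) \<longlonglongrightarrow> flow (2 * s) u"
  proof (rule L2_tendsto_dominated)
    show "square_integrable (\<lambda>x. 2 * \<bar>L2_fun u x\<bar>)"
      by (intro square_integrable_scale square_integrable_bound[OF L2_fun_square_integrable[of u]]) auto
    fix n
    show "AE x in lebesgue. \<bar>L2_fun ((antiderivative (\<tau> n) u - antiderivative s u) /\<^sub>R (\<tau> n - s)) x
        - L2_fun (flow (2 * s) u) x\<bar> \<le> 2 * \<bar>L2_fun u x\<bar>"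
      using ae fl
    proof eventually_elim
      case (elim x)
      have "\<bar>indicator X x * ?q n x - indicator X x * exp (2 * s * h x)\<bar> \<le> 2"
      proof (cases "x \<in> X")
        case True
        have hx: "h x < 0" using h_le_p[OF True] p_neg by simp
        have "\<bar>exp (\<tau> n * (2 * h x)) - exp (s * (2 * h x))\<bar> \<le> \<bar>\<tau> n * (2 * h x) - s * (2 * h x)\<bar>"
          using hx \<tau>(1)[of n] s by (intro abs_exp_diff_le) (auto simp: mult_nonneg_nonpos)
        also have "\<dots> = \<bar>\<tau> n - s\<bar> * \<bar>2 * h x\<bar>"
          unfolding abs_mult[symmetric] left_diff_distrib ..
        finally have "\<bar>exp (\<tau> n * (2 * h x)) - exp (s * (2 * h x))\<bar> \<le> \<bar>\<tau> n - s\<bar> * \<bar>2 * h x\<bar>" .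
        moreover have "\<bar>\<tau> n - s\<bar> * \<bar>2 * h x\<bar> > 0"
          using \<tau>(2)[of n] hx by (intro mult_pos_pos) auto
        ultimately have "\<bar>?q n x\<bar> \<le> 1"
          unfolding abs_divide divide_divide_eq_left by (simp only: divide_le_eq_1_pos)
        moreover have "exp (2 * s * h x) \<le> 1" using exp_h_le_1[OF _ True] s by simp
        moreover have "exp (2 * s * h x) > 0" by simp
        ultimately show ?thesis using True by (simp only: indicator_simps)
      qed simp
      then have "\<bar>indicator X x * ?q n x - indicator X x * exp (2 * s * h x)\<bar> * \<bar>L2_fun u x\<bar>
          \<le> 2 * \<bar>L2_fun u x\<bar>" by (intro mult_right_mono) auto
      then show ?case using elim by (simp add: abs_mult[symmetric] left_diff_distrib)
    qed
  next
    show "AE x in lebesgue. (\<lambda>n. L2_fun ((antiderivative (\<tau> n) u - antiderivative s u) /\<^sub>R (\<tau> n - s)) x)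
        \<longlonglongrightarrow> L2_fun (flow (2 * s) u) x"
      using ae fl
    proof eventually_elim
      case (elim x)
      show ?case
      proof (cases "x \<in> X")
        case True
        have hx: "h x < 0" using h_le_p[OF True] p_neg by simp
        have "(\<lambda>n. ?q n x) \<longlonglongrightarrow> 2 * h x * exp (s * (2 * h x)) / (2 * h x)"
          using hx by (intro tendsto_divide exp_quotient_tendsto \<tau> lim tendsto_const) auto
        then have "(\<lambda>n. ?q n x) \<longlonglongrightarrow> exp (2 * s * h x)" using hx by (simp add: mult_ac)
        then have "(\<lambda>n. ?q n x * L2_fun u x) \<longlonglongrightarrow> exp (2 * s * h x) * L2_fun u x"
          by (intro tendsto_mult tendsto_const)
        then show ?thesis using elim True by simp
      qed (use elim in simp)
    qed
  qed
qed

text \<open>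
  Dominated convergence; along each sequence of times, negative ones are first replaced by \<open>0\<close>, as the
  bound on the multiplier holds at nonnegative times.
\<close>

lemma antiderivative_at_top: "((\<lambda>t. antiderivative t u) \<longlongrightarrow> 0) at_top"
proof (rule tendsto_at_topI_sequentially)
  fix \<tau>' :: "nat \<Rightarrow> real" assume "filterlim \<tau>' at_top sequentially"
  define \<tau> where "\<tau> n = max 0 (\<tau>' n)" for n
  have lim: "filterlim \<tau> at_top sequentially"
    using \<open>filterlim \<tau>' at_top sequentially\<close> by (rule filterlim_at_top_mono) (simp add: \<tau>_def)
  have \<tau>: "\<tau> n \<ge> 0" for n by (simp add: \<tau>_def)
  have ae: "AE x in lebesgue. \<forall>n. L2_fun (antiderivative (\<tau> n) u) x
      = indicator X x * (exp (\<tau> n * (2 * h x)) / (2 * h x)) * L2_fun u x"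
    unfolding AE_all_countable by (intro allI L2_fun_antiderivative \<tau>)
  have "(\<lambda>n. antiderivative (\<tau> n) u) \<longlonglongrightarrow> 0"
  proof (rule L2_tendsto_dominated)
    show "square_integrable (\<lambda>x. 1 / \<bar>2 * p\<bar> * \<bar>L2_fun u x\<bar>)"
      by (intro square_integrable_scale square_integrable_bound[OF L2_fun_square_integrable[of u]]) auto
    fix n
    show "AE x in lebesgue. \<bar>L2_fun (antiderivative (\<tau> n) u) x - L2_fun 0 x\<bar> \<le> 1 / \<bar>2 * p\<bar> * \<bar>L2_fun u x\<bar>"
      using ae L2_fun_zero
    proof eventually_elim
      case (elim x)
      have "\<bar>indicator X x * (exp (\<tau> n * (2 * h x)) / (2 * h x))\<bar> * \<bar>L2_fun u x\<bar>
          \<le> 1 / \<bar>2 * p\<bar> * \<bar>L2_fun u x\<bar>"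
        by (intro mult_right_mono antiderivative_multiplier_bound \<tau>) auto
      then show ?case using elim by (simp only: abs_mult diff_zero)
    qed
  next
    show "AE x in lebesgue. (\<lambda>n. L2_fun (antiderivative (\<tau> n) u) x) \<longlonglongrightarrow> L2_fun 0 x"
      using ae L2_fun_zero
    proof eventually_elim
      case (elim x)
      show ?case
      proof (cases "x \<in> X")
        case True
        have "2 * h x < 0" using h_le_p[OF True] p_neg by simp
        then have "filterlim (\<lambda>n. \<tau> n * (2 * h x)) at_bot sequentially"
          using filterlim_tendsto_neg_mult_at_bot[OF tendsto_const _ lim, of "2 * h x"] by (simp add: mult_ac)
        then have "(\<lambda>n. exp (\<tau> n * (2 * h x))) \<longlonglongrightarrow> 0"
          by (rule filterlim_compose[OF exp_at_bot])
        then have "(\<lambda>n. exp (\<tau> n * (2 * h x)) * (L2_fun u x / (2 * h x))) \<longlonglongrightarrow> 0"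
          by (rule tendsto_mult_left_zero)
        then show ?thesis using elim True by simp
      qed (use elim in simp)
    qed
  qed
  moreover have "\<forall>\<^sub>F n in sequentially. \<tau> n = \<tau>' n"
    using \<open>filterlim \<tau>' at_top sequentially\<close> unfolding filterlim_at_top
    by (auto simp: \<tau>_def max_def elim!: allE[of _ 0] eventually_mono)
  ultimately show "(\<lambda>n. antiderivative (\<tau>' n) u) \<longlonglongrightarrow> 0"
    by (rule Lim_transform_eventually[OF _ eventually_mono]) simp
qed

text \<open>
  The covariance integral is evaluated by the fundamental theorem of calculus, and the contribution of
  the upper limit of integration vanishes for large times.
\<close>

lemma asymptotic_covariance_eq:
  assumes gv: "(g, v) \<in> mult_op X h"
  shows "asymptotic_covariance_op X h \<sigma> (\<lambda>u. u) g = - (\<sigma>\<^sup>2 *\<^sub>R antiderivative 0 g)"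
proof -
  have "covariance_op X h \<sigma> (\<lambda>u. u) t g = \<sigma>\<^sup>2 *\<^sub>R (antiderivative t g - antiderivative 0 g)"
    if "t \<ge> 0" for t
  proof -
    have "((\<lambda>s. flow (2 * s) g) has_integral antiderivative t g - antiderivative 0 g) {0..t}"
      using that by (intro fundamental_theorem_of_calculus antiderivative_has_derivative) auto
    moreover have "integral {0..t} (\<lambda>s. semigroup_exp (L2_on X) (mult_op X h) s
        (semigroup_exp (L2_on X) (mult_op X h) s g)) = integral {0..t} (\<lambda>s. flow (2 * s) g)"
      by (rule integral_cong) (use semigroup_exp_twice_mult_op[OF gv] in auto)
    ultimately show ?thesis unfolding covariance_op_def by (metis integral_unique)
  qed
  then have ev: "\<forall>\<^sub>F t in at_top. \<sigma>\<^sup>2 *\<^sub>R (antiderivative t g - antiderivative 0 g)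
      = covariance_op X h \<sigma> (\<lambda>u. u) t g"
    by (metis (mono_tags, lifting) eventually_at_top_linorderI)
  have "((\<lambda>t. \<sigma>\<^sup>2 *\<^sub>R (antiderivative t g - antiderivative 0 g))
      \<longlongrightarrow> \<sigma>\<^sup>2 *\<^sub>R (0 - antiderivative 0 g)) at_top"
    by (intro tendsto_intros antiderivative_at_top)
  from Lim_transform_eventually[OF this ev] show ?thesis
    unfolding asymptotic_covariance_op_def by (intro tendsto_Lim) auto
qed

lemma inner_asymptotic_covariance:
  assumes gv: "(g, v) \<in> mult_op X h"
  shows "inner (asymptotic_covariance_op X h \<sigma> (\<lambda>u. u) g) g
    = \<sigma>\<^sup>2 / 2 * (\<integral>x. indicator X x * (L2_fun g x)\<^sup>2 / (- h x) \<partial>lebesgue)"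
proof -
  let ?q = "\<lambda>x. indicator X x * (L2_fun g x)\<^sup>2 / (- h x)"
  have m [measurable]: "(\<lambda>x. indicator X x * (1 / - h x)) \<in> borel_measurable lebesgue"
    by (rule measurable_comp_h) measurable
  have "(\<lambda>x. indicator X x * (1 / - h x) * (L2_fun g x)\<^sup>2) \<in> borel_measurable lebesgue"
    by measurable
  also have "(\<lambda>x. indicator X x * (1 / - h x) * (L2_fun g x)\<^sup>2) = ?q"
    by (simp add: fun_eq_iff)
  finally have [measurable]: "?q \<in> borel_measurable lebesgue" .
  have "AE x in lebesgue. L2_fun (antiderivative 0 g) x * L2_fun g x = (- 1 / 2) * ?q x"
    using L2_fun_antiderivative[OF order_refl, of g] by eventually_elim (simp add: power2_eq_square)
  then have "inner (antiderivative 0 g) g = (\<integral>x. (- 1 / 2) * ?q x \<partial>lebesgue)"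
    unfolding inner_L2_fun by (rule integral_cong_AE[rotated 2]) measurable
  also have "\<dots> = (- 1 / 2) * integral\<^sup>L lebesgue ?q"
    by (rule integral_mult_right_zero)
  finally show ?thesis
    unfolding asymptotic_covariance_eq[OF gv] inner_minus_left inner_scaleR_left
    by (simp only:)
qed

lemma inner_asymptotic_covariance_indicator:
  assumes B: "B \<in> lmeasurable" "B \<subseteq> X" and bdd: "bounded (h ` B)"
  shows "inner (asymptotic_covariance_op X h \<sigma> (\<lambda>u. u) (L2_class (indicator B))) (L2_class (indicator B))
    = \<sigma>\<^sup>2 / 2 * (\<integral>x. indicator B x / (- h x) \<partial>lebesgue)"
proof -
  have [measurable]: "B \<in> sets lebesgue" using B by (simp add: fmeasurable_def)
  have "square_integrable (indicator B :: 'a \<Rightarrow> real)"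
    by (rule square_integrable_indicator[OF B(1)])
  then have "AE x in lebesgue. L2_fun (L2_class (indicator B)) x = indicator B x"
    by (rule L2_fun_class)
  then have ae: "AE x in lebesgue. indicator X x * (L2_fun (L2_class (indicator B)) x)\<^sup>2 / (- h x)
      = indicator B x / (- h x)"
    by eventually_elim (use B in \<open>auto simp: indicator_def\<close>)
  have m: "(\<lambda>x. indicator X x * (1 / - h x)) \<in> borel_measurable lebesgue"
    by (rule measurable_comp_h) measurable
  have "(\<integral>x. indicator X x * (L2_fun (L2_class (indicator B)) x)\<^sup>2 / (- h x) \<partial>lebesgue)
      = (\<integral>x. indicator B x / (- h x) \<partial>lebesgue)"
  proof (rule integral_cong_AE[OF _ _ ae])
    have "(\<lambda>x. (indicator X x * (1 / - h x)) * (L2_fun (L2_class (indicator B)) x)\<^sup>2) \<in> borel_measurable lebesgue"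
      by (intro borel_measurable_times m borel_measurable_power L2_fun_measurable)
    then show "(\<lambda>x. indicator X x * (L2_fun (L2_class (indicator B)) x)\<^sup>2 / (- h x)) \<in> borel_measurable lebesgue"
      by (simp add: mult_ac)
    have "(\<lambda>x. indicator B x * (indicator X x * (1 / - h x))) \<in> borel_measurable lebesgue"
      by (intro borel_measurable_times m) simp
    also have "(\<lambda>x. indicator B x * (indicator X x * (1 / - h x))) = (\<lambda>x. indicator B x / (- h x))"
      using B by (auto simp: indicator_def fun_eq_iff)
    finally show "(\<lambda>x. indicator B x / (- h x)) \<in> borel_measurable lebesgue" .
  qed
  then show ?thesis
    using inner_asymptotic_covariance[OF indicator_in_mult_op[OF assms]] by simp
qed

end

section \<open>A linear lower bound for positive power series\<close>

lemma monomial_nonneg: "(\<And>n. 0 \<le> x $ n) \<Longrightarrow> 0 \<le> monomial x j"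
  unfolding monomial_def by (intro prod_nonneg) auto

lemma monomial_mono: "(\<And>n. 0 \<le> x $ n) \<Longrightarrow> (\<And>n. x $ n \<le> y $ n) \<Longrightarrow> monomial x j \<le> monomial y j"
  unfolding monomial_def by (intro prod_mono) (auto intro!: power_mono)

lemma monomial_le_1: "(\<And>n. 0 \<le> x $ n) \<Longrightarrow> (\<And>n. x $ n \<le> 1) \<Longrightarrow> monomial x j \<le> 1"
  unfolding monomial_def by (intro prod_le_1) (auto intro!: power_le_one)

lemma monomial_scaleR: "monomial (c *\<^sub>R x) j = monomial (\<chi> n. c) j * monomial x j"
  unfolding monomial_def by (simp add: power_mult_distrib prod.distrib)

lemma monomial_unit_index [simp]: "monomial x (unit_index m) = x $ m"
proof -
  have "monomial x (unit_index m) = (\<Prod>n\<in>UNIV. if n = m then x $ n else 1)"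
    unfolding monomial_def unit_index_def by (intro prod.cong) auto
  then show ?thesis by simp
qed

lemma monomial_pull_out:
  assumes "j m \<ge> 1"
  shows "monomial x j = x $ m * monomial x (j(m := j m - 1))"
proof -
  have "monomial x j = (x $ m) ^ j m * (\<Prod>n\<in>UNIV - {m}. (x $ n) ^ j n)"
    unfolding monomial_def by (rule prod.remove) auto
  moreover have "monomial x (j(m := j m - 1)) = (x $ m) ^ (j m - 1) * (\<Prod>n\<in>UNIV - {m}. (x $ n) ^ j n)"
    unfolding monomial_def by (subst prod.remove[of _ m]) auto
  moreover have "(x $ m) ^ j m = x $ m * (x $ m) ^ (j m - 1)"
    using assms by (cases "j m") simp_all
  ultimately show ?thesis by simp
qed

lemma monomial_le_coordinate:
  assumes x: "\<And>n. 0 \<le> x $ n" "\<And>n. x $ n \<le> 1" and j: "j \<noteq> (\<lambda>_. 0)"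
    and r: "\<And>n. x $ n \<le> r"
  shows "monomial x j \<le> r"
proof -
  obtain k where "j k \<noteq> 0" using j by auto
  then have "monomial x j = x $ k * monomial x (j(k := j k - 1))"
    by (intro monomial_pull_out) auto
  also have "\<dots> \<le> x $ k * 1" by (intro mult_left_mono monomial_le_1 x)
  finally show ?thesis using r[of k] by simp
qed

text \<open>
  A monomial that contains \<open>x\<^sub>m\<close> and is not \<open>x\<^sub>m\<close> itself has at least one further factor, which is at
  most \<open>r\<close>; all others are at most \<open>1\<close>.
\<close>

lemma monomial_higher_order_le:
  assumes x: "\<And>n. 0 \<le> x $ n" "\<And>n. x $ n \<le> 1" and r: "\<And>n. x $ n \<le> r"
    and j: "j m \<ge> 1" "j \<noteq> unit_index m"
  shows "monomial x j \<le> x $ m * r"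
proof -
  have "j(m := j m - 1) \<noteq> (\<lambda>_. 0)"
  proof
    assume *: "j(m := j m - 1) = (\<lambda>_. 0)"
    have "j n = unit_index m n" for n
      using fun_cong[OF *, of n] j(1) by (auto simp: unit_index_def split: if_splits)
    with j(2) show False by auto
  qed
  then have "monomial x (j(m := j m - 1)) \<le> r" by (intro monomial_le_coordinate x r)
  then have "x $ m * monomial x (j(m := j m - 1)) \<le> x $ m * r" by (intro mult_left_mono x)
  moreover have "monomial x j = x $ m * monomial x (j(m := j m - 1))"
    by (rule monomial_pull_out) (rule j(1))
  ultimately show ?thesis by simp
qed

lemma abs_power_series_summable_at_corner:
  fixes a :: "('n::finite \<Rightarrow> nat) \<Rightarrow> real"
  assumes \<epsilon>: "\<epsilon> > 0" and sm: "(\<lambda>j. a j * monomial (\<chi> n. \<epsilon>) j) summable_on UNIV"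
  shows "(\<lambda>j. \<bar>a j\<bar> * monomial (\<chi> n. \<epsilon>) j) summable_on UNIV"
proof -
  have "monomial (\<chi> n. \<epsilon>) j \<ge> 0" for j :: "'n \<Rightarrow> nat" using \<epsilon> by (intro monomial_nonneg) simp
  then have "norm (a j * monomial (\<chi> n. \<epsilon>) j) = \<bar>a j\<bar> * monomial (\<chi> n. \<epsilon>) j" for j
    by (simp add: abs_mult)
  then show ?thesis using sm[THEN summable_on_iff_abs_summable_on_real[THEN iffD1]] by simp
qed

text \<open>
  The Weierstrass M-test, with the absolute values of the terms at the corner as majorant.
\<close>

lemma continuous_on_power_series:
  fixes a :: "('n::finite \<Rightarrow> nat) \<Rightarrow> real"
  assumes \<epsilon>: "\<epsilon> > 0" and sm: "(\<lambda>j. a j * monomial (\<chi> n. \<epsilon>) j) summable_on UNIV"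
  shows "continuous_on (cbox 0 (\<chi> n. \<epsilon>)) (\<lambda>x. \<Sum>\<^sub>\<infinity>j. a j * monomial x j)"
proof (rule uniform_limit_theorem)
  show "uniform_limit (cbox 0 (\<chi> n. \<epsilon>)) (\<lambda>J x. \<Sum>j\<in>J. a j * monomial x j)
      (\<lambda>x. \<Sum>\<^sub>\<infinity>j. a j * monomial x j) (finite_subsets_at_top UNIV)"
  proof (rule Weierstrass_m_test_general)
    show "(\<lambda>j. \<bar>a j\<bar> * monomial (\<chi> n. \<epsilon>) j) summable_on UNIV"
      by (rule abs_power_series_summable_at_corner[OF \<epsilon> sm])
    fix j :: "'n \<Rightarrow> nat" and x :: "real ^ 'n" assume "x \<in> cbox 0 (\<chi> n. \<epsilon>)"
    then have x: "\<And>n. 0 \<le> x $ n" "\<And>n. x $ n \<le> \<epsilon>" by (auto simp: mem_box_cart)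
    then have "\<bar>monomial x j\<bar> \<le> monomial (\<chi> n. \<epsilon>) j"
      using monomial_nonneg[of x j] monomial_mono[of x "\<chi> n. \<epsilon>" j] by auto
    then show "norm (a j * monomial x j) \<le> \<bar>a j\<bar> * monomial (\<chi> n. \<epsilon>) j"
      by (simp add: abs_mult mult_left_mono)
  qed
  show "\<forall>\<^sub>F J in finite_subsets_at_top UNIV. continuous_on (cbox 0 (\<chi> n. \<epsilon>)) (\<lambda>x. \<Sum>j\<in>J. a j * monomial x j)"
    unfolding monomial_def
    by (intro always_eventually allI continuous_on_sum continuous_on_mult continuous_on_prod
        continuous_on_power continuous_on_const continuous_on_component continuous_on_id)
qed simp

text \<open>
  Setting the coordinates \<open>k\<close> and \<open>l\<close> to zero removes exactly the monomials that contain one of them.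
  Among these, everything but the two linear terms is of higher order: on the box shrunk by the factor
  \<open>r\<close> each such monomial is at most \<open>r (x\<^sub>k + x\<^sub>l) / \<epsilon>\<close> times its value at the corner of the full box.
\<close>

lemma power_series_minus_restriction_ge:
  fixes a :: "('n::finite \<Rightarrow> nat) \<Rightarrow> real"
  defines "F \<equiv> \<lambda>x. \<Sum>\<^sub>\<infinity>j. a j * monomial x j"
  assumes \<epsilon>: "\<epsilon> > 0" and sm: "\<And>x. x \<in> cbox 0 (\<chi> n. \<epsilon>) \<Longrightarrow> (\<lambda>j. a j * monomial x j) summable_on UNIV"
    and kl: "k \<noteq> l"
    and x: "\<And>n. 0 \<le> x $ n" "\<And>n. x $ n \<le> \<epsilon> * r" and r: "0 \<le> r" "r \<le> 1"
  shows "a (unit_index k) * x $ k + a (unit_index l) * x $ l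
      - r / \<epsilon> * (\<Sum>\<^sub>\<infinity>j. \<bar>a j\<bar> * monomial (\<chi> n. \<epsilon>) j) * (x $ k + x $ l)
    \<le> F x - F (\<chi> n. if n = k \<or> n = l then 0 else x $ n)"
proof -
  define y where "y = (\<chi> n. if n = k \<or> n = l then 0 else x $ n)"
  define M where "M j = \<bar>a j\<bar> * monomial (\<chi> n. \<epsilon>) j" for j :: "'n \<Rightarrow> nat"
  have sM: "M summable_on UNIV"
    unfolding M_def[abs_def] using \<epsilon> by (intro abs_power_series_summable_at_corner sm) (auto simp: mem_box_cart)
  have "\<epsilon> * r \<le> \<epsilon>" using \<epsilon> r by (simp add: mult_left_le)
  then have xe: "x $ n \<le> \<epsilon>" for n using x(2)[of n] by linarith
  then have xb: "x \<in> cbox 0 (\<chi> n. \<epsilon>)" and yb: "y \<in> cbox 0 (\<chi> n. \<epsilon>)"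
    using x \<epsilon> by (auto simp: mem_box_cart y_def)
  define c where "c j = a j * monomial x j - a j * monomial y j" for j
  have "((\<lambda>j. a j * monomial x j + - (a j * monomial y j)) has_sum F x + - F y) UNIV"
    by (intro has_sum_add) (simp_all add: F_def has_sum_uminus has_sum_infsum sm xb yb)
  then have cs: "(c has_sum F x - F y) UNIV"
    unfolding c_def[abs_def] by (simp only: diff_conv_add_uminus)
  then have sc: "c summable_on UNIV" and Fxy: "F x - F y = (\<Sum>\<^sub>\<infinity>j. c j)"
    by (auto simp: summable_on_def infsumI)
  have zero: "c j = 0" if "j k = 0" "j l = 0" for j
  proof -
    have "monomial x j = monomial y j"
      unfolding monomial_def y_def using that by (intro prod.cong) auto
    then show ?thesis by (simp add: c_def)
  qed
  have y0: "monomial y j = 0" if "j k \<ge> 1 \<or> j l \<ge> 1" for j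
  proof -
    have "y $ k = 0" "y $ l = 0" by (simp_all add: y_def)
    then show ?thesis using that monomial_pull_out[of j k y] monomial_pull_out[of j l y] by force
  qed
  let ?J = "{unit_index k, unit_index l}"
  let ?K = "r / \<epsilon> * (x $ k + x $ l)"
  have tail: "- (?K * M j) \<le> c j" if "j \<notin> ?J" for j
  proof (cases "j k \<ge> 1 \<or> j l \<ge> 1")
    case False
    then show ?thesis using zero[of j] x r \<epsilon> monomial_nonneg[of "\<chi> n. \<epsilon>" j] by (simp add: M_def)
  next
    case True
    \<comment> \<open>Rescaling to the unit box separates the value at the corner from the smallness of \<open>x\<close>.\<close>
    define z where "z = (1 / \<epsilon>) *\<^sub>R x"
    have z: "0 \<le> z $ n" "z $ n \<le> 1" "z $ n \<le> r" for n
      using x[of n] xe[of n] \<epsilon> by (auto simp: z_def divide_le_eq mult.commute)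
    have xz: "monomial x j = monomial (\<chi> n. \<epsilon>) j * monomial z j"
      using \<epsilon> monomial_scaleR[of \<epsilon> z j] by (simp add: z_def)
    have "monomial z j \<le> (z $ k + z $ l) * r"
    proof (cases "j k \<ge> 1")
      case True
      then have "monomial z j \<le> z $ k * r" using that z by (intro monomial_higher_order_le) auto
      then show ?thesis using z r by (simp add: distrib_right add_increasing2)
    next
      case False
      then have "monomial z j \<le> z $ l * r" using that z True by (intro monomial_higher_order_le) auto
      then show ?thesis using z r by (simp add: distrib_right add_increasing)
    qed
    also have "\<dots> = ?K" by (simp add: z_def add_divide_distrib[symmetric])
    finally have "monomial x j \<le> monomial (\<chi> n. \<epsilon>) j * ?K"
      unfolding xz using \<epsilon> by (intro mult_left_mono monomial_nonneg) auto
    then have "\<bar>a j\<bar> * monomial x j \<le> \<bar>a j\<bar> * (monomial (\<chi> n. \<epsilon>) j * ?K)"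
      by (intro mult_left_mono) auto
    moreover have "- (\<bar>a j\<bar> * monomial x j) \<le> a j * monomial x j"
      using mult_right_mono[OF abs_ge_minus_self[of "a j"] monomial_nonneg[OF x(1), of j]] by simp
    moreover have "c j = a j * monomial x j" using y0[OF True] by (simp add: c_def)
    ultimately show ?thesis by (simp add: M_def mult_ac)
  qed
  have K: "?K \<ge> 0" using x r \<epsilon> by auto
  have "c (unit_index k) + c (unit_index l) - ?K * (\<Sum>\<^sub>\<infinity>j. M j) \<le> (\<Sum>\<^sub>\<infinity>j. c j)"
  proof -
    have ne: "unit_index k \<noteq> unit_index l" using kl by (auto simp: unit_index_def fun_eq_iff)
    have Mn: "M j \<ge> 0" for j using \<epsilon> by (auto simp: M_def intro!: mult_nonneg_nonneg monomial_nonneg)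
    have "(\<Sum>\<^sub>\<infinity>j\<in>-?J. M j) \<le> (\<Sum>\<^sub>\<infinity>j. M j)"
      by (intro infsum_mono2 summable_on_subset_banach[OF sM] sM Mn) auto
    then have "- (?K * (\<Sum>\<^sub>\<infinity>j. M j)) \<le> - ?K * (\<Sum>\<^sub>\<infinity>j\<in>-?J. M j)"
      using mult_left_mono[OF _ K] by simp
    also have "\<dots> = (\<Sum>\<^sub>\<infinity>j\<in>-?J. - ?K * M j)"
      by (rule infsum_cmult_right[symmetric]) (auto intro: summable_on_subset_banach[OF sM])
    also have "\<dots> \<le> (\<Sum>\<^sub>\<infinity>j\<in>-?J. c j)"
      by (intro infsum_mono summable_on_cmult_right summable_on_subset_banach[OF sM]
          summable_on_subset_banach[OF sc]) (use tail in auto)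
    finally have "- (?K * (\<Sum>\<^sub>\<infinity>j. M j)) \<le> (\<Sum>\<^sub>\<infinity>j\<in>-?J. c j)" .
    moreover have "(\<Sum>\<^sub>\<infinity>j. c j) = (\<Sum>\<^sub>\<infinity>j\<in>?J. c j) + (\<Sum>\<^sub>\<infinity>j\<in>-?J. c j)"
      using infsum_Un_disjoint[of c ?J "- ?J"] summable_on_subset_banach[OF sc]
      by (simp add: Compl_partition del: infsum_finite)
    moreover have "(\<Sum>\<^sub>\<infinity>j\<in>?J. c j) = c (unit_index k) + c (unit_index l)" using ne by simp
    ultimately show ?thesis by linarith
  qed
  moreover have "c (unit_index k) = a (unit_index k) * x $ k" "c (unit_index l) = a (unit_index l) * x $ l"
    by (simp_all add: c_def y_def)
  ultimately show ?thesis
    unfolding Fxy[unfolded y_def] M_def by (simp add: mult_ac)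
qed

text \<open>
  On a small box the higher-order rest takes away at most half of the linear terms, and the restriction
  to \<open>x\<^sub>k = x\<^sub>l = 0\<close>, which contains all powers of the other coordinates, is nonnegative. On the compact
  remainder of the box \<open>F\<close> has a positive minimum, while \<open>x\<^sub>k + x\<^sub>l \<le> 2 \<epsilon>\<close>.
\<close>

lemma power_series_ge_linear:
  fixes a :: "('n::finite \<Rightarrow> nat) \<Rightarrow> real"
  defines "F \<equiv> \<lambda>x. \<Sum>\<^sub>\<infinity>j. a j * monomial x j"
  assumes \<epsilon>: "\<epsilon> > 0" and sm: "\<And>x. x \<in> cbox 0 (\<chi> n. \<epsilon>) \<Longrightarrow> (\<lambda>j. a j * monomial x j) summable_on UNIV"
    and kl: "k \<noteq> l" and ak: "a (unit_index k) > 0" and al: "a (unit_index l) > 0"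
    and F0: "F 0 = 0" and pos: "\<And>x. x \<in> cbox 0 (\<chi> n. \<epsilon>) \<Longrightarrow> x \<noteq> 0 \<Longrightarrow> F x > 0"
  obtains c where "c > 0" "\<And>x. x \<in> cbox 0 (\<chi> n. \<epsilon>) \<Longrightarrow> c * (x $ k + x $ l) \<le> F x"
proof -
  let ?B = "cbox (0 :: real ^ 'n) (\<chi> n. \<epsilon>)"
  have Fnn: "F x \<ge> 0" if "x \<in> ?B" for x using pos[OF that] F0 by (cases "x = 0") auto
  define b where "b = min (a (unit_index k)) (a (unit_index l))"
  have b: "b > 0" using ak al by (simp add: b_def)
  define A where "A = (\<Sum>\<^sub>\<infinity>j. \<bar>a j\<bar> * monomial (\<chi> n::'n. \<epsilon>) j)"
  have A: "A \<ge> 0" unfolding A_def using \<epsilon>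
    by (intro infsum_nonneg mult_nonneg_nonneg monomial_nonneg) auto
  \<comment> \<open>The choice of \<open>r\<close> makes the error term of the preceding lemma at most \<open>b / 2\<close>.\<close>
  define r where "r = min 1 (b * \<epsilon> / (2 * (A + 1)))"
  have r: "0 < r" "r \<le> 1" using b \<epsilon> A by (auto simp: r_def)
  have rA: "r / \<epsilon> * A \<le> b / 2"
  proof -
    have "r \<le> b * \<epsilon> / (2 * (A + 1))" by (simp add: r_def)
    then have "r * (A + 1) \<le> b / 2 * \<epsilon>" using A by (simp add: field_simps)
    then have "r * A \<le> b / 2 * \<epsilon>" using r by (simp add: distrib_left)
    then show ?thesis using \<epsilon> by (simp add: field_simps)
  qed
  have small: "b / 2 * (x $ k + x $ l) \<le> F x" if x: "\<And>n. 0 \<le> x $ n" "\<And>n. x $ n \<le> \<epsilon> * r" for x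
  proof -
    let ?y = "\<chi> n. if n = k \<or> n = l then 0 else x $ n"
    have "\<epsilon> * r \<le> \<epsilon>" using \<epsilon> r by (simp add: mult_left_le)
    then have xe: "x $ n \<le> \<epsilon>" for n using x(2)[of n] by linarith
    then have "?y \<in> ?B" using x \<epsilon> by (auto simp: mem_box_cart)
    then have "F ?y \<ge> 0" by (rule Fnn)
    moreover have "a (unit_index k) * x $ k + a (unit_index l) * x $ l
        - r / \<epsilon> * A * (x $ k + x $ l) \<le> F x - F ?y"
      unfolding A_def F_def using r by (intro power_series_minus_restriction_ge \<epsilon> sm kl x) auto
    moreover have "r / \<epsilon> * A * (x $ k + x $ l) \<le> b / 2 * (x $ k + x $ l)"
      using x by (intro mult_right_mono rA) auto
    moreover have "b * x $ k \<le> a (unit_index k) * x $ k" "b * x $ l \<le> a (unit_index l) * x $ l"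
      using x by (auto intro!: mult_right_mono simp: b_def)
    ultimately show ?thesis by (simp add: distrib_left)
  qed
  \<comment> \<open>The part of the box outside the half-open cube on which the estimate near \<open>0\<close> applies.\<close>
  define L where "L = ?B \<inter> (\<Union>n. {x. \<epsilon> * r \<le> x $ n})"
  have "closed (\<Union>n. {x :: real ^ 'n. \<epsilon> * r \<le> x $ n})"
    by (intro closed_UN finite ballI closed_Collect_le continuous_intros)
  then have "compact L" unfolding L_def by (intro compact_Int_closed compact_cbox)
  have "\<exists>m>0. \<forall>x\<in>L. m \<le> F x"
  proof (cases "L = {}")
    case False
    have "continuous_on L F"
      unfolding F_def L_def using \<epsilon>
      by (intro continuous_on_subset[OF continuous_on_power_series[OF \<epsilon> sm]]) (auto simp: mem_box_cart)
    then obtain x where x: "x \<in> L" "\<And>y. y \<in> L \<Longrightarrow> F x \<le> F y"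
      using continuous_attains_inf[OF \<open>compact L\<close> False] by blast
    have "0 < \<epsilon> * r" using \<epsilon> r by simp
    then have "x \<noteq> 0" using x(1) by (auto simp: L_def)
    then have "F x > 0" using x(1) by (intro pos) (auto simp: L_def)
    then show ?thesis using x by blast
  qed (auto intro: exI[of _ 1])
  then obtain m where m: "m > 0" "\<And>x. x \<in> L \<Longrightarrow> m \<le> F x" by blast
  show thesis
  proof (rule that)
    show "min (b / 2) (m / (2 * \<epsilon>)) > 0" using b m \<epsilon> by simp
    fix x assume x: "x \<in> ?B"
    then have xn: "0 \<le> x $ n" "x $ n \<le> \<epsilon>" for n by (auto simp: mem_box_cart)
    show "min (b / 2) (m / (2 * \<epsilon>)) * (x $ k + x $ l) \<le> F x"
    proof (cases "x \<in> L")
      case True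
      have "min (b / 2) (m / (2 * \<epsilon>)) * (x $ k + x $ l) \<le> m / (2 * \<epsilon>) * (\<epsilon> + \<epsilon>)"
        using xn m \<epsilon> by (intro mult_mono add_mono) auto
      also have "\<dots> = m" using \<epsilon> by simp
      finally show ?thesis using m(2)[OF True] by linarith
    next
      case False
      then have "x $ n \<le> \<epsilon> * r" for n using x by (auto simp: L_def not_le intro: less_imp_le)
      then have "b / 2 * (x $ k + x $ l) \<le> F x" using xn by (intro small) auto
      moreover have "min (b / 2) (m / (2 * \<epsilon>)) * (x $ k + x $ l) \<le> b / 2 * (x $ k + x $ l)"
        using xn by (intro mult_right_mono) auto
      ultimately show ?thesis by linarith
    qed
  qed
qed

section \<open>Integrability of the inverse\<close>

lemma nn_integral_inverse_sqrt_finite: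
  fixes c :: real
  assumes "c > 0"
  shows "(\<integral>\<^sup>+t. ennreal (indicator {0..c} t * t powr (- 1 / 2)) \<partial>lborel) < \<infinity>"
proof -
  have "((\<lambda>t. t powr (- 1 / 2)) has_integral (c powr (- 1 / 2 + 1) / (- 1 / 2 + 1))) {0..c}"
    using assms by (intro has_integral_powr_from_0) auto
  from nn_integral_has_integral_lebesgue[OF _ this] show ?thesis by simp
qed

lemma AE_coordinate_nonzero: "AE x in lebesgue. (x :: real ^ 'n::finite) $ n \<noteq> 0"
proof -
  have "negligible {x :: real ^ 'n. x $ n = 0}" by (rule negligible_standard_hyperplane_cart)
  then show ?thesis by (intro AE_I'[of "{x. x $ n = 0}"]) (auto simp: negligible_iff_null_sets)
qed

text \<open>
  By the inequality of arithmetic and geometric means, \<open>1 / (x\<^sub>k + x\<^sub>l) \<le> x\<^sub>k\<^bsup>-1/2\<^esup> x\<^sub>l\<^bsup>-1/2\<^esup>\<close>. The right-hand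
  side is a product of functions of one coordinate, each of which is integrable.
\<close>

lemma inverse_coordinate_sum_integrable:
  fixes k l :: "'n::finite"
  assumes \<epsilon>: "\<epsilon> > 0" and kl: "k \<noteq> l"
  shows "integrable lebesgue (\<lambda>x :: real ^ 'n. indicator (cbox 0 (\<chi> n. \<epsilon>)) x / (x $ k + x $ l))"
proof (rule integrableI_bounded)
  show "(\<lambda>x :: real ^ 'n. indicator (cbox 0 (\<chi> n. \<epsilon>)) x / (x $ k + x $ l)) \<in> borel_measurable lebesgue"
    by (intro measurable_completion) measurable
  let ?p = "\<lambda>t::real. indicator {0..\<epsilon>} t * t powr (- 1 / 2) :: real"
  define \<phi> where "\<phi> b = (if b = axis k 1 \<or> b = axis l 1 then ?p else indicator {0..\<epsilon>})" for b :: "real ^ 'n"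
  have \<phi>m: "\<phi> b \<in> borel_measurable borel" for b unfolding \<phi>_def by simp
  have \<phi>n: "\<phi> b t \<ge> 0" for b t unfolding \<phi>_def by auto
  have nek: "(axis k 1 :: real ^ 'n) \<noteq> axis l 1" using kl by (simp add: axis_eq_axis)
  \<comment> \<open>On the two hyperplanes the bound can fail, because there \<open>0 powr (- 1 / 2) = 0\<close>; they are null sets.\<close>
  have bound: "indicator (cbox 0 (\<chi> n. \<epsilon>)) x / (x $ k + x $ l) \<le> (\<Prod>b\<in>Basis. \<phi> b (x \<bullet> b))"
    if "x $ k \<noteq> 0" "x $ l \<noteq> 0" for x :: "real ^ 'n"
  proof (cases "x \<in> cbox 0 (\<chi> n. \<epsilon>)")
    case True
    then have x: "0 \<le> x $ n" "x $ n \<le> \<epsilon>" for n by (auto simp: mem_box_cart)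
    then have xk: "x $ k > 0" "x $ l > 0" using that by (auto simp: less_le)
    have "(\<Prod>b\<in>Basis. \<phi> b (x \<bullet> b)) = \<phi> (axis k 1) (x \<bullet> axis k 1)
        * (\<Prod>b\<in>Basis - {axis k 1}. \<phi> b (x \<bullet> b))"
      by (rule prod.remove) (auto simp: Basis_vec_def)
    also have "(\<Prod>b\<in>Basis - {axis k 1}. \<phi> b (x \<bullet> b)) = \<phi> (axis l 1) (x \<bullet> axis l 1)
        * (\<Prod>b\<in>Basis - {axis k 1} - {axis l 1}. \<phi> b (x \<bullet> b))"
      using nek by (intro prod.remove) (auto simp: Basis_vec_def)
    also have "(\<Prod>b\<in>Basis - {axis k 1} - {axis l 1}. \<phi> b (x \<bullet> b)) = 1"
      using x by (intro prod.neutral) (auto simp: \<phi>_def Basis_vec_def inner_axis)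
    also have "\<phi> (axis k 1) (x \<bullet> axis k 1) * (\<phi> (axis l 1) (x \<bullet> axis l 1) * 1)
        = (x $ k) powr (- 1 / 2) * (x $ l) powr (- 1 / 2)"
      using x by (simp add: \<phi>_def inner_axis)
    also have "\<dots> = 1 / sqrt (x $ k * x $ l)"
      using xk by (simp add: powr_minus powr_half_sqrt real_sqrt_mult field_simps)
    finally have eq: "(\<Prod>b\<in>Basis. \<phi> b (x \<bullet> b)) = 1 / sqrt (x $ k * x $ l)" .
    have "sqrt (x $ k * x $ l) \<le> (x $ k + x $ l) / 2" using xk by (intro arith_geo_mean_sqrt) auto
    also have "\<dots> \<le> x $ k + x $ l" using xk by simp
    finally have "sqrt (x $ k * x $ l) \<le> x $ k + x $ l" .
    then show ?thesis unfolding eq using True xk by (simp add: frac_le)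
  qed (simp add: prod_nonneg \<phi>n)
  have "(\<integral>\<^sup>+x. ennreal (norm (indicator (cbox 0 (\<chi> n. \<epsilon>)) x / ((x :: real ^ 'n) $ k + x $ l))) \<partial>lebesgue)
      \<le> (\<integral>\<^sup>+x. (\<Prod>b\<in>Basis. ennreal (\<phi> b (x \<bullet> b))) \<partial>lebesgue)"
  proof (rule nn_integral_mono_AE, use AE_coordinate_nonzero[of k] AE_coordinate_nonzero[of l] in eventually_elim)
    case (elim x)
    have "x $ k + x $ l \<ge> 0" if "x \<in> cbox 0 (\<chi> n. \<epsilon>)"
      using that by (auto simp: mem_box_cart intro!: add_nonneg_nonneg)
    then have "norm (indicator (cbox 0 (\<chi> n. \<epsilon>)) x / (x $ k + x $ l))
        = indicator (cbox 0 (\<chi> n. \<epsilon>)) x / (x $ k + x $ l)"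
      by (auto simp: indicator_def)
    also have "\<dots> \<le> (\<Prod>b\<in>Basis. \<phi> b (x \<bullet> b))" using elim by (rule bound)
    finally show ?case by (simp add: prod_ennreal \<phi>n ennreal_leI)
  qed
  also have "\<dots> = (\<Prod>b\<in>Basis. \<integral>\<^sup>+t. ennreal (\<phi> b t) \<partial>lborel)"
    unfolding nn_integral_completion
    using nn_integral_lborel_prod[of "\<lambda>b t. ennreal (\<phi> b t)"] \<phi>m by simp
  also have "\<dots> < \<infinity>"
    using nn_integral_inverse_sqrt_finite[OF \<epsilon>] \<epsilon>
    by (auto simp: \<phi>_def less_top[symmetric] ennreal_prod_eq_top ennreal_indicator)
  finally show "(\<integral>\<^sup>+x. ennreal (norm (indicator (cbox 0 (\<chi> n. \<epsilon>)) x / ((x :: real ^ 'n) $ k + x $ l))) \<partial>lebesgue) < \<infinity>" .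
qed

text \<open>
  A negative shift \<open>p\<close> only increases \<open>\<bar>f + p\<bar>\<close>, so \<open>1 / \<bar>f\<bar>\<close> dominates for all \<open>p\<close> at once.
\<close>

lemma integral_inverse_shift_tendsto:
  fixes f :: "'a::euclidean_space \<Rightarrow> real"
  assumes B [measurable]: "B \<in> sets lebesgue"
    and f_measurable [measurable]: "(\<lambda>x. indicator B x * f x) \<in> borel_measurable lebesgue"
    and w: "integrable lebesgue w"
    and bound: "AE x in lebesgue. x \<in> B \<longrightarrow> f x < 0 \<and> 1 / (- f x) \<le> w x"
    and w_nonneg: "\<And>x. 0 \<le> w x"
  shows "((\<lambda>p. \<integral>x. indicator B x / (- (f x + p)) \<partial>lebesgue)
    \<longlongrightarrow> (\<integral>x. indicator B x / (- f x) \<partial>lebesgue)) (at_left 0)"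
  unfolding tendsto_at_iff_sequentially comp_def
proof (intro allI impI)
  fix q :: "nat \<Rightarrow> real" assume "\<forall>n. q n \<in> {..<0} - {0}" and lim: "q \<longlonglongrightarrow> 0"
  then have q: "\<And>n. q n < 0" by auto
  have m: "(\<lambda>x. indicator B x / (- (f x + p))) \<in> borel_measurable lebesgue" for p
  proof -
    have "(\<lambda>x. indicator B x / (- (indicator B x * f x + p))) \<in> borel_measurable lebesgue"
      by measurable
    also have "(\<lambda>x. indicator B x / (- (indicator B x * f x + p))) = (\<lambda>x. indicator B x / (- (f x + p)))"
      by (auto simp: indicator_def)
    finally show ?thesis .
  qed
  show "(\<lambda>n. \<integral>x. indicator B x / (- (f x + q n)) \<partial>lebesgue) \<longlonglongrightarrow> (\<integral>x. indicator B x / (- f x) \<partial>lebesgue)"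
  proof (rule integral_dominated_convergence[OF _ m w])
    show "(\<lambda>x. indicator B x / (- f x)) \<in> borel_measurable lebesgue"
      using m[of 0] by simp
    show "AE x in lebesgue. (\<lambda>n. indicator B x / (- (f x + q n))) \<longlonglongrightarrow> indicator B x / (- f x)"
      using bound
    proof eventually_elim
      case (elim x)
      have "(\<lambda>n. f x + q n) \<longlonglongrightarrow> f x + 0" by (intro tendsto_intros lim)
      then have "(\<lambda>n. - (f x + q n)) \<longlonglongrightarrow> - f x" by (intro tendsto_minus) simp
      then have "(\<lambda>n. indicator B x / (- (f x + q n))) \<longlonglongrightarrow> indicator B x / (- f x)" if "x \<in> B"
        using elim that by (intro tendsto_divide tendsto_const) auto
      then show ?case by (cases "x \<in> B") auto
    qed
    fix n
    show "AE x in lebesgue. norm (indicator B x / (- (f x + q n))) \<le> w x"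
      using bound
    proof eventually_elim
      case (elim x)
      show ?case
      proof (cases "x \<in> B")
        case True
        have "1 / (- (f x + q n)) \<le> 1 / (- f x)"
          using elim True q[of n] by (intro frac_le) auto
        moreover have "0 \<le> 1 / (- (f x + q n))" using elim True q[of n] by (intro divide_nonneg_nonneg) auto
        ultimately show ?thesis using elim True by (simp del: minus_add_distrib)
      qed (simp add: w_nonneg)
    qed
  qed
qed

section \<open>The limit of the covariance\<close>

theorem proposition4p1:
  fixes X :: "(real ^ 'n) set"
    and f :: "real ^ 'n \<Rightarrow> real"
    and a :: "('n \<Rightarrow> nat) \<Rightarrow> real"
    and \<sigma> :: real
    and i :: "nat \<Rightarrow> 'n"
    and j1 j2 :: "'n \<Rightarrow> nat"
  assumes "CARD('n) > 1"
    and "connected X" and "interior X \<noteq> {}"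
    and "\<sigma> > 0"
    and "\<And>x. x \<in> X \<Longrightarrow> (\<lambda>j. a j * monomial x j) summable_on UNIV"
    and "\<And>x. x \<in> X \<Longrightarrow> f x = - (\<Sum>\<^sub>\<infinity>j\<in>UNIV. a j * monomial x j)"
    and "0 \<in> X" and "f 0 = 0"
    and "\<And>x. x \<in> X - {0} \<Longrightarrow> f x < 0"
    and "\<And>p. p < 0 \<Longrightarrow> set_integrable lebesgue X (\<lambda>x. 1 / \<bar>f x + p\<bar>)"
    and "bij_betw i {1..CARD('n)} UNIV"
    and "a j1 > 0" and "a j2 > 0"
    and "j1 = unit_index (i 1)" and "j2 = unit_index (i 2)"
  shows "\<forall>\<epsilon>>0. cbox 0 (\<chi> n. \<epsilon>) \<subseteq> X \<longrightarrow>
    (let g = L2_class (indicator (cbox 0 (\<chi> n. \<epsilon>)))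
     in \<exists>L::real. ((\<lambda>p. inner (asymptotic_covariance_op X (\<lambda>x. f x + p) \<sigma> (\<lambda>u. u) g) g)
          \<longlongrightarrow> L) (at_left 0))"
proof (intro allI impI)
  fix \<epsilon> :: real assume \<epsilon>: "\<epsilon> > 0" and BX: "cbox 0 (\<chi> n. \<epsilon>) \<subseteq> X"
  let ?B = "cbox 0 (\<chi> n. \<epsilon>) :: (real ^ 'n) set"
  let ?F = "\<lambda>x. \<Sum>\<^sub>\<infinity>j. a j * monomial x j"
  define g where "g = L2_class (indicator ?B :: real ^ 'n \<Rightarrow> real)"
  have f_eq: "f x = - ?F x" if "x \<in> ?B" for x using assms(6) BX that by blast
  have f_nonpos: "f x \<le> 0" if "x \<in> X" for x using assms(8) assms(9)[of x] that by (cases "x = 0") auto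
  have summable: "(\<lambda>j. a j * monomial x j) summable_on UNIV" if "x \<in> ?B" for x
    using assms(5) BX that by blast
  have f_cont: "continuous_on ?B f"
  proof (rule continuous_on_eq)
    show "continuous_on ?B (\<lambda>x. - ?F x)"
      using \<epsilon> by (intro continuous_on_minus continuous_on_power_series summable) (auto simp: mem_box_cart)
  qed (simp add: f_eq)
  have "i 1 \<noteq> i 2"
    using inj_on_eq_iff[OF bij_betw_imp_inj_on[OF assms(11)], of 1 2] assms(1) by simp
  have coeffs: "a (unit_index (i 1)) > 0" "a (unit_index (i 2)) > 0" using assms(12-15) by auto
  have F0: "?F 0 = 0" using f_eq[of 0] assms(8) \<epsilon> by (simp add: mem_box_cart)
  have F_pos: "?F x > 0" if "x \<in> ?B" "x \<noteq> 0" for x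
    using f_eq[OF that(1)] assms(9)[of x] that BX by auto
  obtain c where c: "c > 0" "\<And>x. x \<in> ?B \<Longrightarrow> c * (x $ i 1 + x $ i 2) \<le> ?F x"
    using power_series_ge_linear[OF \<epsilon> summable \<open>i 1 \<noteq> i 2\<close> coeffs F0 F_pos] by blast
  have X_sets: "X \<in> sets lebesgue" and h_meas: "(\<lambda>x. indicator X x * (f x + p)) \<in> borel_measurable lebesgue"
    if p: "p < 0" for p
  proof -
    have neg: "f x + p < 0" if "x \<in> X" for x using f_nonpos[OF that] p by simp
    have [measurable]: "(\<lambda>x. indicator X x * (1 / \<bar>f x + p\<bar>)) \<in> borel_measurable lebesgue"
      using assms(10)[OF p] by (auto simp: set_integrable_def)
    \<comment> \<open>The integrability hypothesis yields both measurability claims: the integrand, extended by zero,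
      vanishes exactly off \<open>X\<close>, and its reciprocal is \<open>- (f + p)\<close> on \<open>X\<close>.\<close>
    have "X = {x \<in> space lebesgue. indicator X x * (1 / \<bar>f x + p\<bar>) \<noteq> 0}"
      using neg by (fastforce simp: indicator_def split: if_splits)
    also have "\<dots> \<in> sets lebesgue" by measurable
    finally show "X \<in> sets lebesgue" .
    have "(\<lambda>x. - (1 / (indicator X x * (1 / \<bar>f x + p\<bar>)))) \<in> borel_measurable lebesgue"
      by measurable
    also have "(\<lambda>x. - (1 / (indicator X x * (1 / \<bar>f x + p\<bar>)))) = (\<lambda>x. indicator X x * (f x + p))"
      using neg by (auto simp: indicator_def fun_eq_iff abs_of_neg)
    finally show "(\<lambda>x. indicator X x * (f x + p)) \<in> borel_measurable lebesgue" .
  qed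
  have inner_value: "inner (asymptotic_covariance_op X (\<lambda>x. f x + p) \<sigma> (\<lambda>u. u) g) g
      = \<sigma>\<^sup>2 / 2 * (\<integral>x. indicator ?B x / (- (f x + p)) \<partial>lebesgue)" if p: "p < 0" for p
  proof -
    interpret strictly_dissipative_multiplier X "\<lambda>x. f x + p" p
      by unfold_locales (use X_sets[OF p] h_meas[OF p] f_nonpos p in \<open>auto simp: add_nonpos_nonpos\<close>)
    have "bounded ((\<lambda>x. f x + p) ` ?B)"
      by (intro compact_imp_bounded compact_continuous_image continuous_intros f_cont compact_cbox)
    then show ?thesis
      unfolding g_def by (intro inner_asymptotic_covariance_indicator BX) auto
  qed
  have "((\<lambda>p. \<integral>x. indicator ?B x / (- (f x + p)) \<partial>lebesgue)
      \<longlongrightarrow> (\<integral>x. indicator ?B x / (- f x) \<partial>lebesgue)) (at_left 0)"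
  proof (rule integral_inverse_shift_tendsto)
    show "(\<lambda>x. indicator ?B x * f x) \<in> borel_measurable lebesgue"
      using borel_measurable_continuous_on_indicator[OF _ f_cont] by (intro measurable_completion) simp
    show "integrable lebesgue (\<lambda>x. 1 / c * (indicator ?B x / (x $ i 1 + x $ i 2)))"
      by (intro integrable_mult_right inverse_coordinate_sum_integrable \<epsilon> \<open>i 1 \<noteq> i 2\<close>)
    \<comment> \<open>Off the null hyperplane \<open>x $ i 1 = 0\<close> the sum in the denominator is positive and \<open>x\<close> is not the origin.\<close>
    show "AE x in lebesgue. x \<in> ?B \<longrightarrow> f x < 0 \<and> 1 / (- f x) \<le> 1 / c * (indicator ?B x / (x $ i 1 + x $ i 2))"
      using AE_coordinate_nonzero[of "i 1"]
    proof (eventually_elim, intro impI)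
      fix x :: "real ^ 'n" assume nz: "x $ i 1 \<noteq> 0" and x: "x \<in> ?B"
      have "x $ i 1 > 0" "x $ i 2 \<ge> 0" using x nz by (auto simp: mem_box_cart less_le)
      then have pos: "c * (x $ i 1 + x $ i 2) > 0" using c(1) by (intro mult_pos_pos) auto
      moreover have le: "c * (x $ i 1 + x $ i 2) \<le> - f x" using c(2)[OF x] f_eq[OF x] by simp
      ultimately have "1 / (- f x) \<le> 1 / (c * (x $ i 1 + x $ i 2))" by (intro frac_le) auto
      then show "f x < 0 \<and> 1 / (- f x) \<le> 1 / c * (indicator ?B x / (x $ i 1 + x $ i 2))"
        using pos le x by simp
    qed
    show "0 \<le> 1 / c * (indicator ?B x / (x $ i 1 + x $ i 2))" for x
      using c(1) by (auto simp: indicator_def mem_box_cart intro!: divide_nonneg_nonneg add_nonneg_nonneg mult_nonneg_nonneg)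
  qed simp
  then have "((\<lambda>p. \<sigma>\<^sup>2 / 2 * (\<integral>x. indicator ?B x / (- (f x + p)) \<partial>lebesgue))
      \<longlongrightarrow> \<sigma>\<^sup>2 / 2 * (\<integral>x. indicator ?B x / (- f x) \<partial>lebesgue)) (at_left 0)"
    by (rule tendsto_mult_left)
  then have "((\<lambda>p. inner (asymptotic_covariance_op X (\<lambda>x. f x + p) \<sigma> (\<lambda>u. u) g) g)
      \<longlongrightarrow> \<sigma>\<^sup>2 / 2 * (\<integral>x. indicator ?B x / (- f x) \<partial>lebesgue)) (at_left 0)"
    by (rule Lim_transform_eventually) (auto simp: inner_value eventually_at_left_field intro!: exI[of _ "-1"])
  then show "let g = L2_class (indicator ?B)
     in \<exists>L. ((\<lambda>p. inner (asymptotic_covariance_op X (\<lambda>x. f x + p) \<sigma> (\<lambda>u. u) g) g) \<longlongrightarrow> L) (at_left 0)"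
    unfolding Let_def g_def by blast
qed

end
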